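(* Let $\mathcal{F}\colon\mathcal{M}\to\mathbb{R}$ be an energy functional with $L^2$ first variation $\frac{\delta}{\delta u}\mathcal{F}$, and let $u_0,u_1\in\mathcal{M}$. Consider the variational problem $$\inf_{v_1,v_2,u}\ \int_0^1\Big[\int_\Omega \tfrac12\|v_1(t,x)\|^2V_1(u(t,x))+\tfrac12|v_2(t,x)|^2V_2(u(t,x))\,dx-\mathcal{F}(u(t,\cdot))\Big]dt$$ over densities $u\colon[0,1]\times\Omega\to\mathbb{R}$, vector fields $v_1\colon[0,1]\times\Omega\to\mathbb{R}^d$ and reaction rates $v_2\colon[0,1]\times\Omega\to\mathbb{R}$ such that $$\partial_tu+\nabla\cdot(V_1(u)v_1)=v_2V_2(u),\qquad u(0,\cdot)=u_0,\quad u(1,\cdot)=u_1 .$$ Let $(v_1,v_2,u)$ be a critical point of this problem with $u(t,x)>0$ for all $t\in[0,1]$. Then there exists a function $\Phi\colon[0,1]\times\Omega\to\mathbb{R}$ such that $$v_1(t,x)=\nabla\Phi(t,x),\qquad v_2(t,x)=\Phi(t,x),$$ and $$\begin{cases}\partial_tu+\nabla\cdot(V_1(u)\nabla\Phi)=V_2(u)\Phi,\\[2pt] \partial_t\Phi+\frac12\|\nabla\Phi\|^2V_1'(u)+\frac12|\Phi|^2V_2'(u)+\frac{\delta}{\delta u}\mathcal{F}(u)=0,\end{cases}$$ with $u(0,x)=u_0(x)$ and $u(1,x)=u_1(x)$.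
   Context: $\Omega\subset\mathbb{R}^d$ is a compact convex spatial domain with periodic boundary conditions (a box with opposite faces identified), so integration by parts in $x$ produces no boundary terms. $\mathcal{M}=\{u\in C^\infty(\Omega):u>0\}$. $F,G,R$ are smooth real functions on $(0,\infty)$ with $F'(u)>0$, $G''(u)>0$ for $u>0$; $V_1(u)=\frac{F'(u)}{G''(u)}$ and $V_2(u)=-\frac{R(u)}{G'(u)}$, where $V_2$ is understood as a smooth positive function on $(0,\infty)$ with $V_2G'=-R$. The $L^2$ first variation is defined by $\frac{d}{d\epsilon}|_{\epsilon=0}\mathcal{F}(u+\epsilon\eta)=\int_\Omega\frac{\delta}{\delta u}\mathcal{F}(u)(x)\,\eta(x)\,dx$ for all $\eta\in C^\infty(\Omega)$. For a smooth path $u(t,\cdot)$ in $\mathcal{M}$ it is assumed smooth in $(t,x)$, and $\epsilon$-differentiation of $\int_0^1\mathcal{F}(u+\epsilon\eta)\,dt$ may be done under the time integral. All functions of $(t,x)$ are smooth. Writing $m_1=V_1(u)v_1$, $m_2=V_2(u)v_2$, the objective becomes $\int_0^1\big[\int_\Omega\frac{\|m_1\|^2}{2V_1(u)}+\frac{|m_2|^2}{2V_2(u)}dx-\mathcal{F}(u)\big]dt$ and the constraint becomes the linear equation $\partial_tu+\nabla\cdot m_1=m_2$. A feasible triple is a critical point if the derivative at $\epsilon=0$ of this objective along $(m_1+\epsilon\mu_1,\,m_2+\epsilon\mu_2,\,u+\epsilon\eta)$ vanishes for all smooth $(\mu_1,\mu_2,\eta)$ with $\partial_t\eta+\nabla\cdot\mu_1=\mu_2$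 and $\eta(0,\cdot)=\eta(1,\cdot)=0$. *)

theory Defs
  imports "HOL-Analysis.Analysis"
begin

(* C^k and C^infinity, with derivatives taken within S. One-sided derivatives at the boundary
   are thus included. Intended for sets S on which derivatives within S are unique, such as open
   sets and convex sets with nonempty interior; below S is UNIV, {0<..} or {0..1} x UNIV. *)
primrec Ck_on :: "nat \<Rightarrow> 'a::euclidean_space set \<Rightarrow> ('a \<Rightarrow> 'b::real_normed_vector) \<Rightarrow> bool" where
  "Ck_on 0 S f \<longleftrightarrow> continuous_on S f"
| "Ck_on (Suc k) S f \<longleftrightarrow>
     f differentiable_on S \<and> (\<forall>h. Ck_on k S (\<lambda>x. frechet_derivative f (at x within S) h))"

definition smooth_on :: "'a::euclidean_space set \<Rightarrow> ('a \<Rightarrow> 'b::real_normed_vector) \<Rightarrow> bool" where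
  "smooth_on S f \<longleftrightarrow> (\<forall>k. Ck_on k S f)"

(* The domain is cbox a b with opposite faces identified. Functions on it are represented by their
   periodic extensions to the whole space, so derivatives need no care at the faces. *)
definition box_periodic :: "real^'n \<Rightarrow> real^'n \<Rightarrow> (real^'n \<Rightarrow> 'b) \<Rightarrow> bool" where
  "box_periodic a b f \<longleftrightarrow> (\<forall>x i. f (x + axis i (b $ i - a $ i)) = f x)"

definition smooth_space :: "real^'n \<Rightarrow> real^'n \<Rightarrow> (real^'n \<Rightarrow> 'b::real_normed_vector) \<Rightarrow> bool" where
  "smooth_space a b f \<longleftrightarrow> smooth_on UNIV f \<and> box_periodic a b f"

(* Values at times outside [0,1] are irrelevant. *)
definition smooth_spacetime ::
    "real^'n \<Rightarrow> real^'n \<Rightarrow> (real \<Rightarrow> real^'n \<Rightarrow> 'b::real_normed_vector) \<Rightarrow> bool" where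
  "smooth_spacetime a b f \<longleftrightarrow>
     smooth_on ({0..1} \<times> UNIV) (\<lambda>(t, x). f t x) \<and> (\<forall>t\<in>{0..1}. box_periodic a b (f t))"

definition densities :: "real^'n \<Rightarrow> real^'n \<Rightarrow> (real^'n \<Rightarrow> real) set" where
  "densities a b = {u. smooth_space a b u \<and> (\<forall>x. 0 < u x)}"

definition smooth_density_path :: "real^'n \<Rightarrow> real^'n \<Rightarrow> (real \<Rightarrow> real^'n \<Rightarrow> real) \<Rightarrow> bool" where
  "smooth_density_path a b u \<longleftrightarrow> smooth_spacetime a b u \<and> (\<forall>t\<in>{0..1}. u t \<in> densities a b)"

definition time_deriv :: "(real \<Rightarrow> real^'n \<Rightarrow> real) \<Rightarrow> real \<Rightarrow> real^'n \<Rightarrow> real" where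
  "time_deriv f t x = vector_derivative (\<lambda>s. f s x) (at t within {0..1})"

definition grad :: "(real^'n \<Rightarrow> real) \<Rightarrow> real^'n \<Rightarrow> real^'n" where
  "grad f x = (\<chi> i. frechet_derivative f (at x) (axis i 1))"

definition divergence :: "(real^'n \<Rightarrow> real^'n) \<Rightarrow> real^'n \<Rightarrow> real" where
  "divergence f x = (\<Sum>i\<in>UNIV. frechet_derivative f (at x) (axis i 1) $ i)"

(* The energy \<F> only matters on densities a b. *)
definition has_first_variation ::
    "real^'n \<Rightarrow> real^'n \<Rightarrow> ((real^'n \<Rightarrow> real) \<Rightarrow> real) \<Rightarrow> ((real^'n \<Rightarrow> real) \<Rightarrow> real^'n \<Rightarrow> real) \<Rightarrow> bool"
  where
  "has_first_variation a b \<F> \<delta>\<F> \<longleftrightarrow>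
     (\<forall>u\<in>densities a b. \<forall>\<eta>. smooth_space a b \<eta> \<longrightarrow>
        ((\<lambda>\<epsilon>. \<F> (\<lambda>x. u x + \<epsilon> * \<eta> x)) has_real_derivative
           integral (cbox a b) (\<lambda>x. \<delta>\<F> u x * \<eta> x)) (at 0))"

(* Along every smooth path of densities: the first variation is smooth in (t,x), the time integral
   of \<F> exists, and it may be differentiated under the integral sign. *)
definition regular_along_paths ::
    "real^'n \<Rightarrow> real^'n \<Rightarrow> ((real^'n \<Rightarrow> real) \<Rightarrow> real) \<Rightarrow> ((real^'n \<Rightarrow> real) \<Rightarrow> real^'n \<Rightarrow> real) \<Rightarrow> bool"
  where
  "regular_along_paths a b \<F> \<delta>\<F> \<longleftrightarrow>
     (\<forall>u. smooth_density_path a b u \<longrightarrow>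
        smooth_spacetime a b (\<lambda>t. \<delta>\<F> (u t)) \<and>
        (\<lambda>t. \<F> (u t)) integrable_on {0..1} \<and>
        (\<forall>\<eta>. smooth_spacetime a b \<eta> \<longrightarrow>
           ((\<lambda>\<epsilon>. integral {0..1} (\<lambda>t. \<F> (\<lambda>x. u t x + \<epsilon> * \<eta> t x))) has_real_derivative
              integral {0..1} (\<lambda>t. deriv (\<lambda>\<epsilon>. \<F> (\<lambda>x. u t x + \<epsilon> * \<eta> t x)) 0)) (at 0)))"

definition mobility :: "(real \<Rightarrow> real) \<Rightarrow> (real \<Rightarrow> real) \<Rightarrow> real \<Rightarrow> real" where
  "mobility F G u = deriv F u / deriv (deriv G) u"

definition action ::
    "real^'n \<Rightarrow> real^'n \<Rightarrow> (real \<Rightarrow> real) \<Rightarrow> (real \<Rightarrow> real) \<Rightarrow> ((real^'n \<Rightarrow> real) \<Rightarrow> real) \<Rightarrow>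
     (real \<Rightarrow> real^'n \<Rightarrow> real^'n) \<Rightarrow> (real \<Rightarrow> real^'n \<Rightarrow> real) \<Rightarrow> (real \<Rightarrow> real^'n \<Rightarrow> real) \<Rightarrow> real" where
  "action a b V1 V2 \<F> v1 v2 u =
     integral {0..1} (\<lambda>t.
       integral (cbox a b) (\<lambda>x. 1/2 * (norm (v1 t x))\<^sup>2 * V1 (u t x) + 1/2 * \<bar>v2 t x\<bar>\<^sup>2 * V2 (u t x))
       - \<F> (u t))"

(* The action in the variables m1 = V1(u) v1, m2 = V2(u) v2; see action_eq_momentum_action. *)
definition momentum_action ::
    "real^'n \<Rightarrow> real^'n \<Rightarrow> (real \<Rightarrow> real) \<Rightarrow> (real \<Rightarrow> real) \<Rightarrow> ((real^'n \<Rightarrow> real) \<Rightarrow> real) \<Rightarrow>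
     (real \<Rightarrow> real^'n \<Rightarrow> real^'n) \<Rightarrow> (real \<Rightarrow> real^'n \<Rightarrow> real) \<Rightarrow> (real \<Rightarrow> real^'n \<Rightarrow> real) \<Rightarrow> real" where
  "momentum_action a b V1 V2 \<F> m1 m2 u =
     integral {0..1} (\<lambda>t.
       integral (cbox a b) (\<lambda>x. (norm (m1 t x))\<^sup>2 / (2 * V1 (u t x)) + \<bar>m2 t x\<bar>\<^sup>2 / (2 * V2 (u t x)))
       - \<F> (u t))"

lemma action_eq_momentum_action:
  assumes "\<And>r. 0 < r \<Longrightarrow> 0 < V1 r" "\<And>r. 0 < r \<Longrightarrow> 0 < V2 r"
    and "\<And>t x. t \<in> {0..1} \<Longrightarrow> 0 < u t x"
  shows "action a b V1 V2 \<F> v1 v2 u =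
    momentum_action a b V1 V2 \<F> (\<lambda>t x. V1 (u t x) *\<^sub>R v1 t x) (\<lambda>t x. V2 (u t x) * v2 t x) u"
proof -
  have "1/2 * (norm (v1 t x))\<^sup>2 * V1 (u t x) + 1/2 * \<bar>v2 t x\<bar>\<^sup>2 * V2 (u t x) =
      (norm (V1 (u t x) *\<^sub>R v1 t x))\<^sup>2 / (2 * V1 (u t x)) +
      \<bar>V2 (u t x) * v2 t x\<bar>\<^sup>2 / (2 * V2 (u t x))"
    if "t \<in> {0..1}" for t x
    using assms(1)[OF assms(3)[OF that, of x]] assms(2)[OF assms(3)[OF that, of x]]
    by (simp add: power_mult_distrib power2_eq_square ac_simps)
  then show ?thesis
    unfolding action_def momentum_action_def by (auto intro!: integral_cong)
qed

definition continuity_equation ::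
    "(real \<Rightarrow> real^'n \<Rightarrow> real^'n) \<Rightarrow> (real \<Rightarrow> real^'n \<Rightarrow> real) \<Rightarrow> (real \<Rightarrow> real^'n \<Rightarrow> real) \<Rightarrow> bool" where
  "continuity_equation m1 m2 u \<longleftrightarrow>
     (\<forall>t\<in>{0..1}. \<forall>x. time_deriv u t x + divergence (m1 t) x = m2 t x)"

definition feasible ::
    "real^'n \<Rightarrow> real^'n \<Rightarrow> (real \<Rightarrow> real) \<Rightarrow> (real \<Rightarrow> real) \<Rightarrow> (real^'n \<Rightarrow> real) \<Rightarrow> (real^'n \<Rightarrow> real) \<Rightarrow>
     (real \<Rightarrow> real^'n \<Rightarrow> real^'n) \<Rightarrow> (real \<Rightarrow> real^'n \<Rightarrow> real) \<Rightarrow> (real \<Rightarrow> real^'n \<Rightarrow> real) \<Rightarrow> bool" where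
  "feasible a b V1 V2 u0 u1 v1 v2 u \<longleftrightarrow>
     smooth_spacetime a b v1 \<and> smooth_spacetime a b v2 \<and> smooth_spacetime a b u \<and>
     continuity_equation (\<lambda>t x. V1 (u t x) *\<^sub>R v1 t x) (\<lambda>t x. v2 t x * V2 (u t x)) u \<and>
     (\<forall>x. u 0 x = u0 x) \<and> (\<forall>x. u 1 x = u1 x)"

(* In the variables (m1, m2, u) the constraint is linear, so admissible perturbations are the
   solutions of the same equation that vanish at times 0 and 1. *)
definition critical_point ::
    "real^'n \<Rightarrow> real^'n \<Rightarrow> (real \<Rightarrow> real) \<Rightarrow> (real \<Rightarrow> real) \<Rightarrow> ((real^'n \<Rightarrow> real) \<Rightarrow> real) \<Rightarrow>
     (real^'n \<Rightarrow> real) \<Rightarrow> (real^'n \<Rightarrow> real) \<Rightarrow>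
     (real \<Rightarrow> real^'n \<Rightarrow> real^'n) \<Rightarrow> (real \<Rightarrow> real^'n \<Rightarrow> real) \<Rightarrow> (real \<Rightarrow> real^'n \<Rightarrow> real) \<Rightarrow> bool" where
  "critical_point a b V1 V2 \<F> u0 u1 v1 v2 u \<longleftrightarrow>
     feasible a b V1 V2 u0 u1 v1 v2 u \<and>
     (\<forall>\<mu>1 \<mu>2 \<eta>.
        smooth_spacetime a b \<mu>1 \<and> smooth_spacetime a b \<mu>2 \<and> smooth_spacetime a b \<eta> \<and>
        continuity_equation \<mu>1 \<mu>2 \<eta> \<and> (\<forall>x. \<eta> 0 x = 0) \<and> (\<forall>x. \<eta> 1 x = 0) \<longrightarrow>
        ((\<lambda>\<epsilon>. momentum_action a b V1 V2 \<F>
                (\<lambda>t x. V1 (u t x) *\<^sub>R v1 t x + \<epsilon> *\<^sub>R \<mu>1 t x)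
                (\<lambda>t x. V2 (u t x) * v2 t x + \<epsilon> * \<mu>2 t x)
                (\<lambda>t x. u t x + \<epsilon> * \<eta> t x)) has_real_derivative 0) (at 0))"

end

theory Submission
  imports Defs
begin

text \<open>Take \<open>\<Phi> = v2\<close>. Every pair \<open>(\<mu>, \<eta>)\<close> with \<open>\<eta>\<close> vanishing at times 0 and 1 becomes an admissible
  perturbation by setting \<open>\<mu>2 = \<partial>\<^sub>t\<eta> + div \<mu>\<close>, so a critical point satisfies
  \<open>\<integral>\<integral> v1 \<bullet> \<mu> + v2 (\<partial>\<^sub>t\<eta> + div \<mu>) - E \<eta> = 0\<close>, where
  \<open>E = 1/2 |v1|\<^sup>2 V1'(u) + 1/2 |v2|\<^sup>2 V2'(u) + \<delta>\<F>(u)\<close>. As all data are smooth, no bump functions are needed: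
  testing with \<open>\<mu> = v1 - \<nabla>v2\<close>, \<open>\<eta> = 0\<close> and integrating by parts in space gives \<open>\<integral>\<integral> |\<mu>|\<^sup>2 = 0\<close>; testing with
  \<open>\<mu> = 0\<close>, \<open>\<eta> = t (1 - t) H\<close>, \<open>H = \<partial>\<^sub>tv2 + E\<close>, and integrating by parts in time gives
  \<open>\<integral>\<integral> t (1 - t) H\<^sup>2 = 0\<close>.\<close>

section \<open>Calculus of C^k functions on a set\<close>

text \<open>The condition under which derivatives within \<open>S\<close> are unique, in the form of
  \<open>frechet_derivative_unique_within\<close>.\<close>

definition approachable :: "'a::euclidean_space set \<Rightarrow> bool" where
  "approachable S \<longleftrightarrow>
     (\<forall>x\<in>S. \<forall>i\<in>Basis. \<forall>e>0. \<exists>d. 0 < \<bar>d\<bar> \<and> \<bar>d\<bar> < e \<and> x + d *\<^sub>R i \<in> S)"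

lemma approachable_open:
  assumes "open S" shows "approachable S"
  unfolding approachable_def
proof (intro ballI allI impI)
  fix x i :: 'a and e :: real
  assume x: "x \<in> S" and i: "i \<in> Basis" and e: "0 < e"
  obtain r where r: "0 < r" "ball x r \<subseteq> S"
    using assms x open_contains_ball by blast
  have "x + (min e r / 2) *\<^sub>R i \<in> S"
    using r i e by (intro subsetD[OF r(2)]) (auto simp: dist_norm)
  with r e show "\<exists>d. 0 < \<bar>d\<bar> \<and> \<bar>d\<bar> < e \<and> x + d *\<^sub>R i \<in> S"
    by (intro exI[of _ "min e r / 2"]) auto
qed

lemma approachable_Times:
  assumes "approachable S" "approachable T" shows "approachable (S \<times> T)"
  unfolding approachable_def
proof (intro ballI allI impI)
  fix z i :: "'a \<times> 'b" and e :: real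
  assume z: "z \<in> S \<times> T" and i: "i \<in> Basis" and e: "0 < e"
  obtain x y where xy: "z = (x, y)" "x \<in> S" "y \<in> T"
    using z by auto
  from i consider j where "j \<in> Basis" "i = (j, 0)" | j where "j \<in> Basis" "i = (0, j)"
    by (auto simp: Basis_prod_def)
  then show "\<exists>d. 0 < \<bar>d\<bar> \<and> \<bar>d\<bar> < e \<and> z + d *\<^sub>R i \<in> S \<times> T"
  proof cases
    case 1
    then show ?thesis using assms(1) e xy unfolding approachable_def by auto
  next
    case 2
    then show ?thesis using assms(2) e xy unfolding approachable_def by auto
  qed
qed

lemma approachable_unit_interval: "approachable {0..1::real}"
  unfolding approachable_def
proof (intro ballI allI impI)
  fix x i e :: real
  assume x: "x \<in> {0..1}" and i: "i \<in> Basis" and e: "0 < e"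
  show "\<exists>d. 0 < \<bar>d\<bar> \<and> \<bar>d\<bar> < e \<and> x + d *\<^sub>R i \<in> {0..1}"
  \<comment> \<open>The step goes right by at most \<open>1 - x\<close> when \<open>x < 1\<close>,
    and left by at most the length 1 of the interval when \<open>x = 1\<close>.\<close>
  proof (cases "x < 1")
    case True
    then show ?thesis using x i e by (intro exI[of _ "min (e/2) (1-x)"]) auto
  next
    case False
    then show ?thesis using x i e by (intro exI[of _ "- min (e/2) 1"]) (auto simp: min_def)
  qed
qed

abbreviation spacetime :: "(real \<times> 'a::euclidean_space) set" where
  "spacetime \<equiv> {0..1} \<times> UNIV"

lemma approachable_spacetime: "approachable spacetime"
  by (intro approachable_Times approachable_unit_interval approachable_open open_UNIV)

lemma has_derivative_unique_approachable:
  assumes "approachable S" "x \<in> S"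
    and "(f has_derivative f') (at x within S)" "(f has_derivative f'') (at x within S)"
  shows "f' = f''"
  using assms by (intro frechet_derivative_unique_within[of f f' x S f'']) (auto simp: approachable_def)

lemma frechet_derivative_eqI:
  assumes "approachable S" "x \<in> S" "(f has_derivative f') (at x within S)"
  shows "frechet_derivative f (at x within S) = f'"
  using assms by (metis frechet_derivative_works differentiableI has_derivative_unique_approachable)

text \<open>At a point of \<open>S\<close>, being a derivative within \<open>S\<close> depends only
  on the values on \<open>S\<close>, and \<open>frechet_derivative\<close> is a choice from that
  predicate. So equality needs neither differentiability nor uniqueness.\<close>

lemma frechet_derivative_within_cong:
  assumes "\<And>y. y \<in> S \<Longrightarrow> f y = g y" "x \<in> S"
  shows "frechet_derivative f (at x within S) = frechet_derivative g (at x within S)"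
proof -
  have "(f has_derivative f') (at x within S) \<longleftrightarrow> (g has_derivative f') (at x within S)" for f'
    using assms by (metis has_derivative_transform)
  then show ?thesis by (simp add: frechet_derivative_def)
qed

lemma Ck_on_cong:
  assumes "\<And>x. x \<in> S \<Longrightarrow> f x = g x"
  shows "Ck_on k S f \<longleftrightarrow> Ck_on k S g"
  using assms
proof (induction k arbitrary: f g)
  case 0
  then show ?case by (auto intro: continuous_on_cong)
next
  case (Suc k)
  have "f differentiable_on S \<longleftrightarrow> g differentiable_on S"
    unfolding differentiable_on_def differentiable_def
    using Suc.prems by (metis has_derivative_transform)
  moreover have "Ck_on k S (\<lambda>x. frechet_derivative f (at x within S) h) \<longleftrightarrow>
      Ck_on k S (\<lambda>x. frechet_derivative g (at x within S) h)" for h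
    by (rule Suc.IH) (use Suc.prems frechet_derivative_within_cong[of S f g] in auto)
  ultimately show ?case by simp
qed

text \<open>Lets an explicit derivative stand in for the chosen \<open>frechet_derivative\<close> in
  \<open>Ck_on\<close>, since the two coincide on an approachable set. The rules below climb from
  order \<open>k\<close> to \<open>Suc k\<close> through it.\<close>

lemma Ck_on_SucI:
  assumes "approachable S" "\<And>x. x \<in> S \<Longrightarrow> (f has_derivative f' x) (at x within S)"
    and "\<And>h. Ck_on k S (\<lambda>x. f' x h)"
  shows "Ck_on (Suc k) S f"
proof -
  have "f differentiable_on S"
    using assms(2) by (auto simp: differentiable_on_def intro: differentiableI)
  moreover have "Ck_on k S (\<lambda>x. frechet_derivative f (at x within S) h)" for h
    using assms(3)[of h] frechet_derivative_eqI[OF assms(1) _ assms(2)]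
    by (subst Ck_on_cong[of S _ "\<lambda>x. f' x h"]) auto
  ultimately show ?thesis by simp
qed

lemma Ck_on_Suc_has_derivative:
  assumes "Ck_on (Suc k) S f" "x \<in> S"
  shows "(f has_derivative frechet_derivative f (at x within S)) (at x within S)"
  using assms by (auto simp: differentiable_on_def frechet_derivative_works)

lemma Ck_on_SucD: "Ck_on (Suc k) S f \<Longrightarrow> Ck_on k S f"
  by (induction k arbitrary: f) (auto simp: differentiable_imp_continuous_on)

lemma Ck_on_const:
  assumes "approachable S" shows "Ck_on k S (\<lambda>x. c)"
proof (induction k arbitrary: c)
  case (Suc k)
  show ?case
    by (rule Ck_on_SucI[OF assms has_derivative_const]) (rule Suc)
qed auto

lemma Ck_on_add:
  assumes "approachable S" "Ck_on k S f" "Ck_on k S g"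
  shows "Ck_on k S (\<lambda>x. f x + g x)"
  using assms(2,3)
proof (induction k arbitrary: f g)
  case (Suc k)
  show ?case
    by (rule Ck_on_SucI[OF assms(1) has_derivative_add[OF Suc.prems[THEN Ck_on_Suc_has_derivative]]])
      (use Suc in auto)
qed (auto intro: continuous_intros)

text \<open>The product rule gives a sum of two terms of the same shape, each with one factor
  differentiated; \<open>Ck_on_SucD\<close> lowers the other factor to order \<open>k\<close>, and
  the induction closes. A general \<open>p\<close> covers products, scalar multiples and inner
  products at once.\<close>

lemma Ck_on_bilinear:
  assumes "bounded_bilinear p" "approachable S" "Ck_on k S f" "Ck_on k S g"
  shows "Ck_on k S (\<lambda>x. p (f x) (g x))"
  using assms(3,4)
proof (induction k arbitrary: f g)
  case 0
  then show ?case using bounded_bilinear.continuous_on[OF assms(1)] by auto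
next
  case (Suc k)
  have "Ck_on k S f" "Ck_on k S g"
    using Suc.prems Ck_on_SucD by blast+
  then show ?case
    by (intro Ck_on_SucI[OF assms(2)
        bounded_bilinear.FDERIV[OF assms(1) Suc.prems[THEN Ck_on_Suc_has_derivative]]]
        Ck_on_add assms Suc.IH)
      (use Suc in auto)
qed

section \<open>Closure rules for smooth functions\<close>

lemma smooth_on_const: "approachable S \<Longrightarrow> smooth_on S (\<lambda>x. c)"
  by (simp add: smooth_on_def Ck_on_const)

lemma smooth_on_add:
  "approachable S \<Longrightarrow> smooth_on S f \<Longrightarrow> smooth_on S g \<Longrightarrow> smooth_on S (\<lambda>x. f x + g x)"
  by (simp add: smooth_on_def Ck_on_add)

lemma smooth_on_bilinear:
  "bounded_bilinear p \<Longrightarrow> approachable S \<Longrightarrow> smooth_on S f \<Longrightarrow> smooth_on S g \<Longrightarrow>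
    smooth_on S (\<lambda>x. p (f x) (g x))"
  by (simp add: smooth_on_def Ck_on_bilinear)

lemma smooth_on_cong:
  "(\<And>x. x \<in> S \<Longrightarrow> f x = g x) \<Longrightarrow> smooth_on S f \<longleftrightarrow> smooth_on S g"
  unfolding smooth_on_def using Ck_on_cong[of S f g] by auto

lemma smooth_on_frechet_derivative:
  "smooth_on S f \<Longrightarrow> smooth_on S (\<lambda>x. frechet_derivative f (at x within S) h)"
  unfolding smooth_on_def by (metis Ck_on.simps(2))

lemma smooth_on_has_derivative:
  "smooth_on S f \<Longrightarrow> x \<in> S \<Longrightarrow>
    (f has_derivative frechet_derivative f (at x within S)) (at x within S)"
  unfolding smooth_on_def using Ck_on_Suc_has_derivative by blast

lemma smooth_on_continuous_on: "smooth_on S f \<Longrightarrow> continuous_on S f"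
  unfolding smooth_on_def by (metis Ck_on.simps(1))

text \<open>A bounded linear map is its own derivative at every point, so its directional
  derivatives are constants. A case distinction on \<open>k\<close> therefore replaces
  induction.\<close>

lemma smooth_on_linear:
  assumes "approachable S" "bounded_linear f" shows "smooth_on S f"
  unfolding smooth_on_def
proof
  fix k
  show "Ck_on k S f"
    by (cases k)
      (simp_all only: Ck_on.simps(1) bounded_linear.continuous_on[OF assms(2) continuous_on_id]
        Ck_on_SucI[OF assms(1) bounded_linear_imp_has_derivative[OF assms(2)] Ck_on_const[OF assms(1)]])
qed

text \<open>The derivative of the slice in direction \<open>h\<close> is the slice of the derivative
  in direction \<open>(0, h)\<close>, so the induction runs over all \<open>f\<close>. This also
  holds at the end times, because the slice through \<open>t\<close> lies in
  \<open>spacetime\<close>.\<close>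

lemma Ck_on_slice:
  fixes f :: "real \<times> 'a::euclidean_space \<Rightarrow> 'b::real_normed_vector"
  assumes "Ck_on k spacetime f" "t \<in> {0..1}"
  shows "Ck_on k UNIV (\<lambda>x. f (t, x))"
  using assms(1)
proof (induction k arbitrary: f)
  case 0
  then have "continuous_on spacetime f" by simp
  moreover have "continuous_on UNIV (Pair t :: 'a \<Rightarrow> _)"
    by (intro continuous_on_Pair continuous_on_const continuous_on_id)
  moreover have "range (Pair t :: 'a \<Rightarrow> _) \<subseteq> spacetime"
    using assms(2) by auto
  ultimately show ?case
    using continuous_on_compose2[of spacetime f UNIV "Pair t"] by simp
next
  case (Suc k)
  have "((\<lambda>x. f (t, x)) has_derivative
      (\<lambda>h. frechet_derivative f (at (t, x) within spacetime) (0, h))) (at x)" for x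
  proof -
    have "((\<lambda>x. (t, x)) has_derivative (\<lambda>h. (0, h))) (at x within UNIV)"
      by (intro has_derivative_Pair has_derivative_const has_derivative_ident)
    moreover have "(f has_derivative frechet_derivative f (at (t, x) within spacetime))
        (at (t, x) within Pair t ` UNIV)"
      by (rule has_derivative_subset[OF Ck_on_Suc_has_derivative[OF Suc.prems]]) (use assms in auto)
    ultimately show ?thesis
      by (rule has_derivative_in_compose)
  qed
  moreover have "Ck_on k UNIV (\<lambda>x. frechet_derivative f (at (t, x) within spacetime) (0, h))" for h
    by (rule Suc.IH[of "\<lambda>z. frechet_derivative f (at z within spacetime) (0, h)"])
      (use Suc.prems in simp)
  ultimately show ?case
    by (rule Ck_on_SucI[OF approachable_open[OF open_UNIV]])
qed

lemma smooth_on_pos_has_derivative: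
  fixes f :: "real \<Rightarrow> real"
  assumes "smooth_on {0<..} f" "0 < r"
  shows "(f has_real_derivative deriv f r) (at r)"
proof -
  have "f differentiable (at r)"
    using smooth_on_has_derivative[OF assms(1), of r] assms(2) at_within_open[of r "{0<..}"]
    by (simp add: differentiableI)
  then show ?thesis
    using DERIV_deriv_iff_real_differentiable by blast
qed

lemma smooth_on_pos_deriv:
  fixes f :: "real \<Rightarrow> real"
  assumes "smooth_on {0<..} f" shows "smooth_on {0<..} (deriv f)"
proof -
  have "frechet_derivative f (at r within {0<..}) 1 = deriv f r" if "r \<in> {0<..}" for r
    using that smooth_on_pos_has_derivative[OF assms, of r]
    by (subst frechet_derivative_eqI[of _ _ _ "\<lambda>h. deriv f r * h"])
      (auto simp: has_field_derivative_def intro: approachable_open has_derivative_at_withinI)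
  then show ?thesis
    using smooth_on_frechet_derivative[OF assms, of 1] by (subst smooth_on_cong[symmetric]) auto
qed

text \<open>The chain rule produces \<open>deriv f\<close> composed with \<open>g\<close>, so
  \<open>f\<close> must vary in the induction; it can, being smooth of every order. Positivity keeps
  the values of \<open>g\<close> in the domain of \<open>f\<close>.\<close>

lemma Ck_on_compose_pos:
  fixes f :: "real \<Rightarrow> real"
  assumes "approachable S" "smooth_on {0<..} f" "Ck_on k S g" "\<And>x. x \<in> S \<Longrightarrow> 0 < g x"
  shows "Ck_on k S (\<lambda>x. f (g x))"
  using assms(2,3)
proof (induction k arbitrary: f)
  case 0
  then show ?case
    using assms(4) continuous_on_compose2[OF smooth_on_continuous_on[OF 0(1)], of S g]
    by (simp add: image_subset_iff)
next
  case (Suc k)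
  have "Ck_on k S (\<lambda>x. deriv f (g x))"
    by (rule Suc.IH[OF smooth_on_pos_deriv[OF Suc.prems(1)] Ck_on_SucD[OF Suc.prems(2)]])
  moreover have "((\<lambda>x. f (g x)) has_derivative
      (\<lambda>h. deriv f (g x) * frechet_derivative g (at x within S) h)) (at x within S)" if "x \<in> S" for x
    using has_derivative_compose[OF Ck_on_Suc_has_derivative[OF Suc.prems(2) that]
        smooth_on_pos_has_derivative[OF Suc.prems(1) assms(4)[OF that], unfolded has_field_derivative_def]] .
  ultimately show ?case
    using Suc.prems(2)
    by (intro Ck_on_SucI[OF assms(1), where f' = "\<lambda>x h. deriv f (g x) * frechet_derivative g (at x within S) h"]
        Ck_on_bilinear[OF bounded_bilinear_mult assms(1)]) auto
qed

lemma smooth_on_compose_pos: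
  fixes f :: "real \<Rightarrow> real"
  assumes "approachable S" "smooth_on {0<..} f" "smooth_on S g" "\<And>x. x \<in> S \<Longrightarrow> 0 < g x"
  shows "smooth_on S (\<lambda>x. f (g x))"
  using assms Ck_on_compose_pos unfolding smooth_on_def[of S] by blast

text \<open>The derivative of the inverse is minus its own square, so regularity of order
  \<open>k\<close> bootstraps itself to order \<open>Suc k\<close> by the product rule.\<close>

lemma smooth_on_inverse_pos: "smooth_on {0<..} (inverse :: real \<Rightarrow> real)"
proof -
  have S: "approachable {0::real<..}" by (intro approachable_open) auto
  have "Ck_on k {0::real<..} inverse" for k
  proof (induction k)
    case (Suc k)
    have "Ck_on k {0<..} (\<lambda>x::real. (-h) * (inverse x * inverse x))" for h
      by (intro Ck_on_bilinear[OF bounded_bilinear_mult S] Ck_on_const[OF S] Suc)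
    moreover have "(inverse has_derivative (\<lambda>h. (-h) * (inverse x * inverse x))) (at x within {0<..})"
      if "x \<in> {0<..}" for x :: real
      using that has_derivative_inverse'[of x "{0<..}"] by (simp add: mult_ac)
    ultimately show ?case
      by (rule Ck_on_SucI[OF S, rotated])
  next
    case 0
    have "continuous_on {0::real<..} (\<lambda>x. inverse x)"
      by (intro continuous_on_inverse continuous_on_id ballI) simp
    then show ?case by simp
  qed
  then show ?thesis unfolding smooth_on_def by blast
qed

section \<open>Smooth functions on space-time\<close>

text \<open>A single linear map, one-sided in time at the end times, from which
  \<open>time_deriv\<close> is read off in direction \<open>(1, 0)\<close> and the space derivatives
  in directions \<open>(0, h)\<close>. Smoothness of all of them thus reduces to
  \<open>smooth_spacetime_derivative\<close>.\<close>

definition spacetime_derivative ::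
    "(real \<Rightarrow> real^'n \<Rightarrow> 'b::real_normed_vector) \<Rightarrow> real \<Rightarrow> real^'n \<Rightarrow> real \<times> (real^'n) \<Rightarrow> 'b" where
  "spacetime_derivative f t x = frechet_derivative (\<lambda>(t, x). f t x) (at (t, x) within spacetime)"

lemma smooth_spacetime_cong:
  assumes "\<And>t x. t \<in> {0..1} \<Longrightarrow> f t x = g t x"
  shows "smooth_spacetime a b f \<longleftrightarrow> smooth_spacetime a b g"
proof -
  have "smooth_on spacetime (\<lambda>(t, x). f t x) \<longleftrightarrow> smooth_on spacetime (\<lambda>(t, x). g t x)"
    using assms by (intro smooth_on_cong) auto
  then show ?thesis
    using assms by (simp add: smooth_spacetime_def box_periodic_def)
qed

lemma smooth_spacetime_const: "smooth_spacetime a b (\<lambda>t x. c)"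
  using smooth_on_const[OF approachable_spacetime, of c]
  by (simp add: smooth_spacetime_def box_periodic_def split_def)

lemma smooth_spacetime_time: "smooth_spacetime a b (\<lambda>t x. t)"
  using smooth_on_linear[OF approachable_spacetime bounded_linear_fst]
  by (simp add: smooth_spacetime_def box_periodic_def split_def)

lemma smooth_spacetime_add:
  "smooth_spacetime a b f \<Longrightarrow> smooth_spacetime a b g \<Longrightarrow> smooth_spacetime a b (\<lambda>t x. f t x + g t x)"
  using smooth_on_add[OF approachable_spacetime, of "\<lambda>(t, x). f t x" "\<lambda>(t, x). g t x"]
  by (simp add: smooth_spacetime_def box_periodic_def split_def)

lemma smooth_spacetime_bilinear:
  "bounded_bilinear p \<Longrightarrow> smooth_spacetime a b f \<Longrightarrow> smooth_spacetime a b g \<Longrightarrow>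
    smooth_spacetime a b (\<lambda>t x. p (f t x) (g t x))"
  using smooth_on_bilinear[OF _ approachable_spacetime, of p "\<lambda>(t, x). f t x" "\<lambda>(t, x). g t x"]
  by (simp add: smooth_spacetime_def box_periodic_def split_def)

lemmas smooth_spacetime_mult = smooth_spacetime_bilinear[OF bounded_bilinear_mult]
lemmas smooth_spacetime_scaleR = smooth_spacetime_bilinear[OF bounded_bilinear_scaleR]
lemmas smooth_spacetime_inner = smooth_spacetime_bilinear[OF bounded_bilinear_inner]

lemma smooth_spacetime_diff:
  assumes "smooth_spacetime a b f" "smooth_spacetime a b g"
  shows "smooth_spacetime a b (\<lambda>t x. f t x - g t x)"
  using smooth_spacetime_add[OF assms(1)
      smooth_spacetime_scaleR[OF smooth_spacetime_const[of a b "-1"] assms(2)]]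
  by simp

lemma smooth_spacetime_sum:
  "(\<And>i. i \<in> I \<Longrightarrow> smooth_spacetime a b (f i)) \<Longrightarrow> smooth_spacetime a b (\<lambda>t x. \<Sum>i\<in>I. f i t x)"
  by (induction I rule: infinite_finite_induct)
    (simp_all add: smooth_spacetime_const smooth_spacetime_add)

lemma smooth_spacetime_compose_pos:
  fixes g :: "real \<Rightarrow> real"
  assumes "smooth_on {0<..} g" "smooth_spacetime a b f" "\<And>t x. t \<in> {0..1} \<Longrightarrow> 0 < f t x"
  shows "smooth_spacetime a b (\<lambda>t x. g (f t x))"
proof -
  have "smooth_on spacetime (\<lambda>z. g ((\<lambda>(t, x). f t x) z))"
    using assms by (intro smooth_on_compose_pos[OF approachable_spacetime assms(1)])
      (auto simp: smooth_spacetime_def)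
  then show ?thesis
    using assms(2) by (simp add: smooth_spacetime_def box_periodic_def split_def)
qed

lemma spacetime_has_derivative:
  assumes "smooth_spacetime a b f" "t \<in> {0..1}"
  shows "((\<lambda>(t, x). f t x) has_derivative spacetime_derivative f t x) (at (t, x) within spacetime)"
  using assms smooth_on_has_derivative unfolding smooth_spacetime_def spacetime_derivative_def by blast

text \<open>Only periodicity needs an argument. Translation by a period maps
  \<open>spacetime\<close> into itself and leaves \<open>f\<close> unchanged, so the derivative at
  the translated point is also a derivative at \<open>(t, x)\<close>; uniqueness identifies the
  two.\<close>

lemma smooth_spacetime_derivative:
  assumes "smooth_spacetime a b f"
  shows "smooth_spacetime a b (\<lambda>t x. spacetime_derivative f t x h)"
proof -
  have "smooth_on spacetime (\<lambda>(t, x). spacetime_derivative f t x h)"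
    using smooth_on_frechet_derivative[of spacetime "\<lambda>(t, x). f t x" h] assms
    by (simp add: smooth_spacetime_def spacetime_derivative_def split_def)
  moreover have "spacetime_derivative f t (x + axis i (b $ i - a $ i)) = spacetime_derivative f t x"
    if t: "t \<in> {0..1}" for t x i
  proof -
    define p where "p = axis i (b $ i - a $ i)"
    let ?f = "\<lambda>(t, x). f t x"
    have "((\<lambda>z. z + (0, p)) has_derivative (\<lambda>h. h)) (at (t, x) within spacetime)"
      by (auto intro!: derivative_eq_intros)
    moreover have "(?f has_derivative spacetime_derivative f t (x + p))
        (at ((t, x) + (0, p)) within (\<lambda>z. z + (0, p)) ` spacetime)"
    proof -
      have "(\<lambda>z. z + (0, p)) ` spacetime \<subseteq> spacetime" by auto
      with has_derivative_subset[OF spacetime_has_derivative[OF assms t, of "x + p"]]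
      show ?thesis by simp
    qed
    ultimately have "((\<lambda>z. ?f (z + (0, p))) has_derivative spacetime_derivative f t (x + p))
        (at (t, x) within spacetime)"
      by (rule has_derivative_in_compose)
    then have "(?f has_derivative spacetime_derivative f t (x + p)) (at (t, x) within spacetime)"
      by (rule has_derivative_transform[rotated 2])
        (use assms t in \<open>auto simp: smooth_spacetime_def box_periodic_def p_def\<close>)
    then show ?thesis
      using has_derivative_unique_approachable[OF approachable_spacetime _ _
          spacetime_has_derivative[OF assms t, of x]] t
      by (simp add: p_def)
  qed
  ultimately show ?thesis
    by (simp add: smooth_spacetime_def box_periodic_def)
qed

lemma smooth_spacetime_continuous_on:
  "smooth_spacetime a b f \<Longrightarrow> continuous_on spacetime (\<lambda>(t, x). f t x)"
  by (simp add: smooth_spacetime_def smooth_on_continuous_on)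

lemma smooth_spacetime_slice:
  assumes "smooth_spacetime a b f" "t \<in> {0..1}" shows "smooth_space a b (f t)"
  using assms Ck_on_slice[OF _ assms(2), of _ "\<lambda>(t, x). f t x"]
  by (simp add: smooth_spacetime_def smooth_space_def smooth_on_def)

lemma spacetime_has_space_derivative:
  assumes "smooth_spacetime a b f" "t \<in> {0..1}"
  shows "(f t has_derivative (\<lambda>h. spacetime_derivative f t x (0, h))) (at x)"
proof -
  have "((\<lambda>x. (t, x)) has_derivative (\<lambda>h. (0, h))) (at x within UNIV)"
    by (intro has_derivative_Pair has_derivative_const has_derivative_ident)
  moreover have "((\<lambda>(t, x). f t x) has_derivative spacetime_derivative f t x)
      (at (t, x) within Pair t ` UNIV)"
    by (rule has_derivative_subset[OF spacetime_has_derivative[OF assms]]) (use assms in auto)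
  ultimately show ?thesis
    using has_derivative_in_compose[of "Pair t" _ x UNIV "\<lambda>(t, x). f t x"] by simp
qed

lemma spacetime_has_time_derivative:
  assumes "smooth_spacetime a b f" "t \<in> {0..1}"
  shows "((\<lambda>s. f s x) has_vector_derivative spacetime_derivative f t x (1, 0)) (at t within {0..1})"
proof -
  have "((\<lambda>s. (s, x)) has_derivative (\<lambda>h. (h, 0))) (at t within {0..1})"
    by (intro has_derivative_Pair has_derivative_const has_derivative_ident)
  moreover have "((\<lambda>(t, x). f t x) has_derivative spacetime_derivative f t x)
      (at (t, x) within (\<lambda>s. (s, x)) ` {0..1})"
    by (rule has_derivative_subset[OF spacetime_has_derivative[OF assms]]) auto
  ultimately have *: "((\<lambda>s. f s x) has_derivative (\<lambda>h. spacetime_derivative f t x (h, 0)))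
      (at t within {0..1})"
    using has_derivative_in_compose[of "\<lambda>s. (s, x)" _ t "{0..1}" "\<lambda>(t, x). f t x"] by simp
  have "spacetime_derivative f t x (h, 0) = h *\<^sub>R spacetime_derivative f t x (1, 0)" for h
    using linear_scale[OF has_derivative_linear[OF spacetime_has_derivative[OF assms, of x]], of h "(1, 0)"]
    by simp
  then have "(\<lambda>h. spacetime_derivative f t x (h, 0)) = (\<lambda>h. h *\<^sub>R spacetime_derivative f t x (1, 0))"
    by blast
  with * show ?thesis by (simp only: has_vector_derivative_def)
qed

section \<open>Time derivative, gradient and divergence of smooth fields\<close>

lemma time_deriv_eq:
  assumes "smooth_spacetime a b f" "t \<in> {0..1}"
  shows "time_deriv f t x = spacetime_derivative f t x (1, 0)"
  unfolding time_deriv_def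
  by (rule vector_derivative_within_cbox[of 0 1, simplified])
    (use assms in \<open>auto intro: spacetime_has_time_derivative\<close>)

lemma frechet_derivative_space_eq:
  assumes "smooth_spacetime a b f" "t \<in> {0..1}"
  shows "frechet_derivative (f t) (at x) h = spacetime_derivative f t x (0, h)"
  using frechet_derivative_at[OF spacetime_has_space_derivative[OF assms, of x]] by metis

text \<open>In this form the gradient is built from sums, scalar multiples and constants, so its
  smoothness follows from the closure rules.\<close>

lemma grad_eq_sum: "grad f x = (\<Sum>i\<in>UNIV. frechet_derivative f (at x) (axis i 1) *\<^sub>R axis i 1)"
  by (simp add: grad_def vec_eq_iff axis_def if_distrib cong: if_cong)

lemma grad_inner: "grad f x \<bullet> v = (\<Sum>i\<in>UNIV. frechet_derivative f (at x) (axis i 1) * v $ i)"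
  by (simp add: grad_def inner_vec_def)

lemma smooth_spacetime_frechet_derivative:
  assumes "smooth_spacetime a b f"
  shows "smooth_spacetime a b (\<lambda>t x. frechet_derivative (f t) (at x) h)"
  using smooth_spacetime_derivative[OF assms, of "(0, h)"] frechet_derivative_space_eq[OF assms]
  by (subst smooth_spacetime_cong) auto

lemma smooth_spacetime_time_deriv:
  assumes "smooth_spacetime a b f" shows "smooth_spacetime a b (time_deriv f)"
  using smooth_spacetime_derivative[OF assms, of "(1, 0)"] time_deriv_eq[OF assms]
  by (subst smooth_spacetime_cong) auto

lemma smooth_spacetime_grad:
  assumes "smooth_spacetime a b f" shows "smooth_spacetime a b (\<lambda>t. grad (f t))"
  unfolding grad_eq_sum
  by (intro smooth_spacetime_sum smooth_spacetime_scaleR smooth_spacetime_const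
      smooth_spacetime_frechet_derivative assms)

lemma smooth_spacetime_component:
  fixes m :: "real \<Rightarrow> real^'n \<Rightarrow> real^'k"
  assumes "smooth_spacetime a b m" shows "smooth_spacetime a b (\<lambda>t x. m t x $ i)"
  using smooth_spacetime_inner[OF assms smooth_spacetime_const[of a b "axis i 1"]]
  by (simp add: inner_axis)

lemma smooth_spacetime_divergence:
  assumes "smooth_spacetime a b m" shows "smooth_spacetime a b (\<lambda>t. divergence (m t))"
  unfolding divergence_def
  by (intro smooth_spacetime_sum smooth_spacetime_component
      smooth_spacetime_frechet_derivative assms)

text \<open>The product rule behind integration by parts in space: \<open>f\<close> times a
  divergence is an exact divergence minus a gradient term.\<close>

lemma divergence_scaleR:
  assumes "f differentiable at x" "m differentiable at x"
  shows "divergence (\<lambda>y. f y *\<^sub>R m y) x = grad f x \<bullet> m x + f x * divergence m x"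
proof -
  have "frechet_derivative (\<lambda>y. f y *\<^sub>R m y) (at x) =
      (\<lambda>h. f x *\<^sub>R frechet_derivative m (at x) h + frechet_derivative f (at x) h *\<^sub>R m x)"
    using assms[unfolded frechet_derivative_works]
    by (intro frechet_derivative_at[symmetric] has_derivative_scaleR)
  then show ?thesis
    by (simp add: divergence_def grad_inner sum.distrib sum_distrib_left add.commute)
qed

section \<open>Periodic functions\<close>

lemma axis_zero: "axis i 0 = 0"
  by (simp add: vec_eq_iff axis_def)

lemma box_periodic_int_multiple:
  fixes a b x :: "real^'n"
  assumes "box_periodic a b f"
  shows "f (x + axis i (of_int k * (b $ i - a $ i))) = f x"
proof -
  have nat: "f (x + axis i (of_nat n * (b $ i - a $ i))) = f x" for n x
  proof (induction n)
    case 0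
    show ?case by (simp add: axis_zero)
  next
    case (Suc n)
    have "x + axis i (of_nat (Suc n) * (b $ i - a $ i)) =
        (x + axis i (of_nat n * (b $ i - a $ i))) + axis i (b $ i - a $ i)"
      by (simp add: vec_eq_iff axis_def algebra_simps)
    then show ?case using Suc assms unfolding box_periodic_def by metis
  qed
  show ?thesis
  proof (cases k)
    case (nonneg n)
    then show ?thesis using nat[of x n] by simp
  next
    \<comment> \<open>Shifting the already shifted point by \<open>Suc n\<close> positive periods
      leads back to \<open>x\<close>, so the natural number case applied there gives the
      claim.\<close>
    case (neg n)
    have "real_of_int k = - of_nat (Suc n)" using neg by simp
    then have "x = (x + axis i (of_int k * (b $ i - a $ i))) + axis i (of_nat (Suc n) * (b $ i - a $ i))"
      by (simp only: vec_eq_iff) (simp add: axis_def del: of_nat_Suc)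
    then show ?thesis using nat by metis
  qed
qed

text \<open>Carries pointwise facts from the compact box, where extrema and integrals are available,
  to the whole space.\<close>

lemma box_periodic_representative:
  fixes a b x :: "real^'n"
  assumes box: "\<And>i. a $ i < b $ i" and f: "box_periodic a b f"
  obtains y where "y \<in> cbox a b" "f x = f y"
proof -
  \<comment> \<open>\<open>k i\<close> is minus the number of whole periods between
    \<open>a $ i\<close> and \<open>x $ i\<close>, so adding \<open>k i\<close> periods leaves only
    the fractional part, which places coordinate \<open>i\<close> in the box. The partial sums
    \<open>s I\<close> correct the coordinates one at a time.\<close>
  define k where "k i = - \<lfloor>(x $ i - a $ i) / (b $ i - a $ i)\<rfloor>" for i
  define s where "s I = (\<Sum>i\<in>I. axis i (of_int (k i) * (b $ i - a $ i)))" for I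
  have "f (x + s I) = f x" if "finite I" for I
    using that
  proof (induction I)
    case (insert i I)
    then have "x + s (insert i I) = (x + s I) + axis i (of_int (k i) * (b $ i - a $ i))"
      by (simp add: s_def)
    then show ?case using insert box_periodic_int_multiple[OF f] by metis
  qed (simp add: s_def)
  then have "f x = f (x + s UNIV)" by simp
  moreover have "x + s UNIV \<in> cbox a b"
    unfolding mem_box_cart
  proof
    fix i
    let ?L = "b $ i - a $ i" and ?q = "(x $ i - a $ i) / (b $ i - a $ i)"
    have L: "0 < ?L" using box by simp
    have "s UNIV $ i = of_int (k i) * ?L"
      by (simp add: s_def axis_def if_distrib cong: if_cong)
    moreover have "x $ i = a $ i + ?q * ?L" using L by (simp add: field_simps)
    ultimately have eq: "(x + s UNIV) $ i = a $ i + (?q - of_int \<lfloor>?q\<rfloor>) * ?L"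
      by (simp add: k_def left_diff_distrib)
    have "0 \<le> ?q - of_int \<lfloor>?q\<rfloor>" "?q - of_int \<lfloor>?q\<rfloor> \<le> 1" by linarith+
    then have "0 \<le> (?q - of_int \<lfloor>?q\<rfloor>) * ?L" "(?q - of_int \<lfloor>?q\<rfloor>) * ?L \<le> 1 * ?L"
      using L by (auto intro: mult_nonneg_nonneg mult_right_mono)
    then show "a $ i \<le> (x + s UNIV) $ i \<and> (x + s UNIV) $ i \<le> b $ i"
      unfolding eq by simp
  qed
  ultimately show thesis using that by blast
qed

text \<open>The box stretched by \<open>s\<close> along axis \<open>i\<close> is cut in two ways:
  into the original box and a slab at its upper end, and into a slab at its lower end and the
  shifted box. The two slabs differ by one period, so they carry equal integrals and cancel.\<close>

lemma integral_periodic_shift: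
  fixes f :: "real^'n \<Rightarrow> real"
  assumes cont: "continuous_on UNIV f" and f: "box_periodic a b f"
    and s: "0 \<le> s" "s \<le> b $ i - a $ i"
  shows "integral (cbox a b) (\<lambda>x. f (x + axis i s)) = integral (cbox a b) f"
proof -
  define L where "L = b $ i - a $ i"
  have int: "f integrable_on cbox c d" for c d
    by (intro integrable_continuous continuous_on_subset[OF cont]) auto
  have shift: "integral (cbox c d) (\<lambda>x. f (x + p)) = integral (cbox (c + p) (d + p)) f" for c d p
    using integral_shift_cbox[where a = "c + p" and b = "d + p" and c = p and f = f] by simp
  have split: "integral (cbox c d) f =
      integral (cbox c d \<inter> {x. x $ i \<le> e}) f + integral (cbox c d \<inter> {x. x $ i \<ge> e}) f" for c d e
  proof -
    have *: "f integrable_on (cbox c d \<inter> {x. x \<bullet> axis i 1 \<le> e})"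
        "f integrable_on (cbox c d \<inter> {x. x \<bullet> axis i 1 \<ge> e})"
      by (intro integrable_split[OF int]; simp)+
    from has_integral_split[OF *[THEN integrable_integral]] show ?thesis
      by (intro integral_unique) (simp add: inner_axis)
  qed
  let ?a = "a + axis i s" and ?b = "b + axis i s"
  have a1: "cbox a ?b \<inter> {x. x $ i \<le> b $ i} = cbox a b"
    and a2: "cbox a ?b \<inter> {x. x $ i \<ge> b $ i} = cbox (a + axis i L) (b + axis i s)"
    and b1: "cbox a ?b \<inter> {x. x $ i \<le> a $ i + s} = cbox a (b + axis i (s - L))"
    and b2: "cbox a ?b \<inter> {x. x $ i \<ge> a $ i + s} = cbox ?a ?b"
    using s unfolding L_def by (auto simp: mem_box_cart axis_def split: if_splits) (smt (verit))+
  have "integral (cbox a (b + axis i (s - L))) f = integral (cbox a (b + axis i (s - L))) (\<lambda>x. f (x + axis i L))"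
    using f by (simp add: box_periodic_def L_def)
  also have "\<dots> = integral (cbox (a + axis i L) (b + axis i s)) f"
  proof -
    have "b + axis i (s - L) + axis i L = b + axis i s" by (simp add: vec_eq_iff axis_def)
    then show ?thesis by (simp only: shift)
  qed
  finally show ?thesis
    using split[of a ?b "b $ i"] split[of a ?b "a $ i + s"] shift[of a b "axis i s"]
    unfolding a1 a2 b1 b2 by simp
qed

text \<open>By Leibniz' rule the integral is the derivative of the integral of a translate, which does
  not depend on the translation.\<close>

lemma integral_periodic_partial_derivative:
  fixes f :: "real^'n \<Rightarrow> real"
  assumes box: "\<And>i. a $ i < b $ i" and f: "smooth_space a b f"
  shows "integral (cbox a b) (\<lambda>x. frechet_derivative f (at x) (axis i 1)) = 0"
proof -
  \<comment> \<open>Translations range over one period, where \<open>integral_periodic_shift\<close>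
    applies, so the derivative at 0 is one-sided.\<close>
  let ?U = "{0..b $ i - a $ i}" and ?D = "\<lambda>x. frechet_derivative f (at x)"
  have smooth: "smooth_on UNIV f" and per: "box_periodic a b f"
    using f by (auto simp: smooth_space_def)
  have df: "(f has_derivative ?D x) (at x)" for x
    using smooth_on_has_derivative[OF smooth, of x] by simp
  define e where "e = (axis i 1 :: real^'n)"
  have cD: "continuous_on UNIV (\<lambda>x. ?D x e)"
    using smooth_on_continuous_on[OF smooth_on_frechet_derivative[OF smooth, of e]] by simp
  have axis: "axis i s = s *\<^sub>R e" for s
    by (simp add: e_def vec_eq_iff axis_def)
  have ca: "continuous_on A (\<lambda>z. axis i (g z) :: real^'n)" if "continuous_on A g"
    for A :: "'z::topological_space set" and g
    unfolding axis using that by (intro continuous_intros)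
  have "((\<lambda>s. integral (cbox a b) (\<lambda>x. f (x + axis i s))) has_field_derivative
      integral (cbox a b) (\<lambda>x. ?D (x + axis i 0) e)) (at 0 within ?U)"
  proof (rule leibniz_rule_field_derivative)
    show "((\<lambda>s. f (x + axis i s)) has_field_derivative ?D (x + axis i s) e) (at s within ?U)"
      for s x
    proof -
      have "((\<lambda>s. x + axis i s) has_derivative (\<lambda>h. axis i h)) (at s within ?U)"
        unfolding axis by (auto intro!: derivative_eq_intros)
      from has_derivative_compose[OF this df] show ?thesis
        using linear_scale[OF has_derivative_linear[OF df], of _ _ e]
        by (simp add: has_field_derivative_def axis mult_commute_abs)
    qed
    show "(\<lambda>x. f (x + axis i s)) integrable_on cbox a b" for s
      by (intro integrable_continuous continuous_on_compose2[OF smooth_on_continuous_on[OF smooth]]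
          continuous_intros) auto
    have "continuous_on (?U \<times> cbox a b) (\<lambda>z. ?D (snd z + axis i (fst z)) e)"
      by (intro continuous_on_compose2[OF cD] continuous_intros ca) auto
    then show "continuous_on (?U \<times> cbox a b) (\<lambda>(s, x). ?D (x + axis i s) e)"
      by (simp add: split_def)
  qed (use box[of i] in auto)
  moreover have "((\<lambda>s. integral (cbox a b) (\<lambda>x. f (x + axis i s))) has_field_derivative 0)
      (at 0 within ?U)"
    by (rule has_field_derivative_transform_within[OF DERIV_const[of "integral (cbox a b) f"] zero_less_one])
      (use box[of i] integral_periodic_shift[OF smooth_on_continuous_on[OF smooth] per]
        in \<open>auto simp: less_imp_le\<close>)
  \<comment> \<open>The two one-sided derivatives agree because 0 is a limit point of
    \<open>?U\<close>, the period being positive.\<close>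
  ultimately have "integral (cbox a b) (\<lambda>x. ?D (x + axis i 0) e) = 0"
    by (rule has_field_derivative_unique) (use box[of i] in \<open>auto simp: trivial_limit_within\<close>)
  then show ?thesis by (simp add: axis_zero e_def)
qed

text \<open>Each summand of the divergence is the partial derivative along axis \<open>i\<close> of
  the periodic function \<open>m x $ i\<close>, so it integrates to zero by
  \<open>integral_periodic_partial_derivative\<close>.\<close>

lemma integral_divergence_periodic:
  fixes m :: "real^'n \<Rightarrow> real^'n"
  assumes box: "\<And>i. a $ i < b $ i" and m: "smooth_space a b m"
  shows "integral (cbox a b) (divergence m) = 0"
proof -
  have smooth: "smooth_on UNIV m" using m by (simp add: smooth_space_def)
  have comp: "smooth_space a b (\<lambda>x. m x $ i)" for i
    using m smooth_on_bilinear[OF bounded_bilinear_inner approachable_open[OF open_UNIV] smooth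
        smooth_on_const[OF approachable_open[OF open_UNIV], of "axis i 1"]]
    by (simp add: smooth_space_def box_periodic_def inner_axis)
  have D: "frechet_derivative (\<lambda>x. m x $ i) (at x) h = frechet_derivative m (at x) h $ i" for i x h
  proof -
    have "((\<lambda>x. m x $ i) has_derivative (\<lambda>h. frechet_derivative m (at x) h $ i)) (at x)"
      using smooth_on_has_derivative[OF smooth, of x]
      by (intro bounded_linear.has_derivative[OF bounded_linear_vec_nth]) simp
    from frechet_derivative_at[OF this] show ?thesis by metis
  qed
  have "(\<lambda>x. frechet_derivative (\<lambda>x. m x $ i) (at x) (axis i 1)) integrable_on cbox a b" for i
    using smooth_on_continuous_on[OF smooth_on_frechet_derivative, of UNIV "\<lambda>x. m x $ i" "axis i 1"] comp[of i]
    by (intro integrable_continuous) (auto simp: smooth_space_def intro: continuous_on_subset)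
  moreover have "divergence m = (\<lambda>x. \<Sum>i\<in>UNIV. frechet_derivative (\<lambda>x. m x $ i) (at x) (axis i 1))"
    by (simp add: fun_eq_iff divergence_def D)
  ultimately show ?thesis
    using integral_periodic_partial_derivative[OF box comp] by (simp add: integral_sum)
qed

section \<open>Integrals over space-time\<close>

lemma spacetime_cbox: "cbox (0, a) (1, b) = {0..1::real} \<times> cbox a b"
  by (simp add: cbox_Pair_eq)

lemma integral_spacetime:
  fixes f :: "real \<Rightarrow> real^'n \<Rightarrow> 'b::banach"
  assumes "continuous_on spacetime (\<lambda>(t, x). f t x)"
  shows "integral (cbox (0, a) (1, b)) (\<lambda>(t, x). f t x) = integral {0..1} (\<lambda>t. integral (cbox a b) (f t))"
proof -
  have "continuous_on (cbox (0, a) (1, b)) (\<lambda>(t, x). f t x)"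
    by (rule continuous_on_subset[OF assms]) (auto simp: spacetime_cbox)
  from integral_prod_continuous[OF this] show ?thesis by simp
qed

text \<open>Swapping the order of integration puts time innermost, where the fundamental theorem of
  calculus leaves \<open>f 1 x - f 0 x\<close>, which is zero.\<close>

lemma integral_time_deriv:
  fixes f :: "real \<Rightarrow> real^'n \<Rightarrow> real"
  assumes f: "smooth_spacetime a b f" and 0: "\<And>x. f 0 x = 0" "\<And>x. f 1 x = 0"
  shows "integral (cbox (0, a) (1, b)) (\<lambda>(t, x). time_deriv f t x) = 0"
proof -
  have c: "continuous_on (cbox (0, a) (1, b)) (\<lambda>(t, x). time_deriv f t x)"
    by (rule continuous_on_subset[OF smooth_spacetime_continuous_on[OF smooth_spacetime_time_deriv[OF f]]])
      (auto simp: spacetime_cbox)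
  have "continuous_on (cbox (a, 0) (b, 1)) (\<lambda>(x, t). time_deriv f t x)"
  proof -
    have "continuous_on (cbox (a, 0) (b, 1)) (\<lambda>z. (\<lambda>(t, x). time_deriv f t x) (prod.swap z))"
      by (rule continuous_on_compose2[OF c]) (auto simp: cbox_Pair_eq intro!: continuous_intros)
    then show ?thesis by (simp add: split_def)
  qed
  from integral_prod_continuous[OF this]
  have "integral (cbox (0, a) (1, b)) (\<lambda>(t, x). time_deriv f t x) =
      integral (cbox a b) (\<lambda>x. integral {0..1} (\<lambda>t. time_deriv f t x))"
    using integral_swap_2dim[OF c] by simp
  moreover have "integral {0..1} (\<lambda>t. time_deriv f t x) = 0" for x
  proof -
    have "((\<lambda>t. time_deriv f t x) has_integral (f 1 x - f 0 x)) {0..1}"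
      by (rule fundamental_theorem_of_calculus)
        (use spacetime_has_time_derivative[OF f] time_deriv_eq[OF f] in simp_all)
    then show ?thesis using 0 by (simp add: integral_unique)
  qed
  ultimately show ?thesis by simp
qed

text \<open>Takes the place of the fundamental lemma of the calculus of variations. A continuous
  nonnegative function with zero integral vanishes on a box with nonempty interior, and periodicity
  extends this to every \<open>x\<close>.\<close>

lemma smooth_spacetime_eq_0I:
  fixes f :: "real \<Rightarrow> real^'n \<Rightarrow> real"
  assumes box: "\<And>i. a $ i < b $ i" and f: "smooth_spacetime a b f"
    and nonneg: "\<And>t x. t \<in> {0..1} \<Longrightarrow> 0 \<le> f t x"
    and int: "integral (cbox (0, a) (1, b)) (\<lambda>(t, x). f t x) = 0"
    and t: "t \<in> {0..1}"
  shows "f t x = 0"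
proof -
  obtain y where y: "y \<in> cbox a b" "f t x = f t y"
    using box_periodic_representative[OF box] f t by (metis smooth_spacetime_def)
  let ?K = "cbox (0::real, a) (1, b)"
  have c: "continuous_on ?K (\<lambda>(t, x). f t x)"
    by (rule continuous_on_subset[OF smooth_spacetime_continuous_on[OF f]]) (auto simp: spacetime_cbox)
  have "box (0::real, a) (1, b) \<noteq> {}"
    using box by (auto simp: box_ne_empty Basis_prod_def Basis_vec_def inner_axis)
  moreover have "((\<lambda>(t, x). f t x) has_integral 0) ?K"
    using integrable_integral[OF integrable_continuous[OF c]] int by simp
  moreover have "0 \<le> (\<lambda>(t, x). f t x) z" if "z \<in> box (0, a) (1, b)" for z
    using subsetD[OF box_subset_cbox that] nonneg by (auto simp: spacetime_cbox)
  ultimately have "(\<lambda>(t, x). f t x) (t, y) = 0"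
    by (intro has_integral_0_cbox_imp_0[OF c, of "(t, y)"]) (use t y in \<open>auto simp: spacetime_cbox\<close>)
  with y show ?thesis by simp
qed

text \<open>Leibniz' rule applies on \<open>{-r<..<r}\<close>, where the perturbed density stays in
  the domain of \<open>V\<close> and the denominators do not vanish. The inner product space
  \<open>'c\<close> allows both the vector field \<open>m1\<close> and the scalar
  \<open>m2\<close>.\<close>

lemma kinetic_integral_derivative:
  fixes M N :: "'a::euclidean_space \<Rightarrow> 'c::real_inner" and u \<eta> :: "'a \<Rightarrow> real" and V :: "real \<Rightarrow> real"
  assumes V: "smooth_on {0<..} V" "\<And>r. 0 < r \<Longrightarrow> 0 < V r"
    and cont: "continuous_on (cbox a b) M" "continuous_on (cbox a b) N"
      "continuous_on (cbox a b) u" "continuous_on (cbox a b) \<eta>"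
    and r: "0 < r" and pos: "\<And>\<epsilon> z. \<epsilon> \<in> {-r<..<r} \<Longrightarrow> z \<in> cbox a b \<Longrightarrow> 0 < u z + \<epsilon> * \<eta> z"
  shows "((\<lambda>\<epsilon>. integral (cbox a b) (\<lambda>z. (norm (M z + \<epsilon> *\<^sub>R N z))\<^sup>2 / (2 * V (u z + \<epsilon> * \<eta> z))))
    has_real_derivative
      integral (cbox a b) (\<lambda>z. M z \<bullet> N z / V (u z)
        - (norm (M z))\<^sup>2 * deriv V (u z) * \<eta> z / (2 * (V (u z))\<^sup>2))) (at 0)"
proof -
  let ?U = "{-r<..<r}" and ?K = "cbox a b"
  let ?w = "\<lambda>\<epsilon> z. u z + \<epsilon> * \<eta> z" and ?m = "\<lambda>\<epsilon> z. M z + \<epsilon> *\<^sub>R N z"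
  let ?D = "\<lambda>\<epsilon> z. ?m \<epsilon> z \<bullet> N z / V (?w \<epsilon> z)
    - (norm (?m \<epsilon> z))\<^sup>2 * deriv V (?w \<epsilon> z) * \<eta> z / (2 * (V (?w \<epsilon> z))\<^sup>2)"
  have "((\<lambda>\<epsilon>. integral ?K (\<lambda>z. (norm (?m \<epsilon> z))\<^sup>2 / (2 * V (?w \<epsilon> z)))) has_real_derivative
      integral ?K (?D 0)) (at 0 within ?U)"
  proof (rule leibniz_rule_field_derivative)
    fix \<epsilon> z assume \<epsilon>: "\<epsilon> \<in> ?U" and z: "z \<in> ?K"
    have V': "((\<lambda>\<epsilon>. V (?w \<epsilon> z)) has_real_derivative deriv V (?w \<epsilon> z) * \<eta> z) (at \<epsilon> within ?U)"
      by (rule DERIV_chain2[where g = "\<lambda>\<epsilon>. ?w \<epsilon> z", OF smooth_on_pos_has_derivative[OF V(1) pos[OF \<epsilon> z]]])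
        (auto intro!: derivative_eq_intros)
    have n': "((\<lambda>\<epsilon>. ?m \<epsilon> z \<bullet> ?m \<epsilon> z) has_real_derivative 2 * (?m \<epsilon> z \<bullet> N z)) (at \<epsilon> within ?U)"
    proof -
      have "((\<lambda>\<epsilon>. ?m \<epsilon> z) has_derivative (\<lambda>h. h *\<^sub>R N z)) (at \<epsilon> within ?U)"
        by (auto intro!: derivative_eq_intros)
      from has_derivative_inner[OF this this] show ?thesis
        by (rule has_derivative_imp_has_field_derivative) (simp add: inner_commute)
    qed
    have "V (?w \<epsilon> z) \<noteq> 0" using V(2)[OF pos[OF \<epsilon> z]] by simp
    then show "((\<lambda>\<epsilon>. (norm (?m \<epsilon> z))\<^sup>2 / (2 * V (?w \<epsilon> z))) has_real_derivative ?D \<epsilon> z) (at \<epsilon> within ?U)"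
      unfolding power2_norm_eq_inner
      by (auto intro!: derivative_eq_intros n' V' simp: power2_eq_square field_simps)
  next
    fix \<epsilon> assume \<epsilon>: "\<epsilon> \<in> ?U"
    have "continuous_on ?K (\<lambda>z. V (?w \<epsilon> z))"
      by (rule continuous_on_compose2[OF smooth_on_continuous_on[OF V(1)]])
        (use pos[OF \<epsilon>] cont in \<open>auto intro!: continuous_intros\<close>)
    moreover have "V (?w \<epsilon> z) \<noteq> 0" if "z \<in> ?K" for z
      using V(2)[OF pos[OF \<epsilon> that]] by simp
    ultimately show "(\<lambda>z. (norm (?m \<epsilon> z))\<^sup>2 / (2 * V (?w \<epsilon> z))) integrable_on ?K"
      by (intro integrable_continuous continuous_intros cont) auto
  next
    have snd: "continuous_on (?U \<times> ?K) (\<lambda>y. g (snd y))" if "continuous_on ?K g"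
      for g :: "'a \<Rightarrow> 'z::topological_space"
      by (rule continuous_on_compose2[OF that]) (auto intro!: continuous_intros)
    have w: "continuous_on (?U \<times> ?K) (\<lambda>y. g (?w (fst y) (snd y)))" if "smooth_on {0<..} g"
      for g :: "real \<Rightarrow> real"
      by (rule continuous_on_compose2[OF smooth_on_continuous_on[OF that]])
        (use pos in \<open>auto intro!: continuous_intros snd cont\<close>)
    have "V (?w (fst y) (snd y)) \<noteq> 0" if "y \<in> ?U \<times> ?K" for y
      using V(2)[OF pos] that by (metis less_irrefl mem_Times_iff)
    then have "continuous_on (?U \<times> ?K) (\<lambda>y. ?D (fst y) (snd y))"
      by (intro continuous_intros snd w V smooth_on_pos_deriv cont) auto
    then show "continuous_on (?U \<times> ?K) (\<lambda>(\<epsilon>, z). ?D \<epsilon> z)"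
      by (simp add: split_def)
  qed (use r in auto)
  then show ?thesis
    using r by (simp add: at_within_open[of 0 "{-r<..<r}"])
qed

section \<open>The weak form of the critical point equation\<close>

text \<open>On one compact space-time cell \<open>u\<close> attains a positive minimum and \<eta> is
  bounded, so one radius serves all times and points; periodicity handles points outside the
  box.\<close>

lemma perturbed_density_pos:
  fixes u \<eta> :: "real \<Rightarrow> real^'n \<Rightarrow> real"
  assumes box: "\<And>i. a $ i < b $ i"
    and u: "smooth_spacetime a b u" "\<And>t x. t \<in> {0..1} \<Longrightarrow> 0 < u t x"
    and \<eta>: "smooth_spacetime a b \<eta>"
  obtains r where "0 < r" "\<And>\<epsilon> t x. \<epsilon> \<in> {-r<..<r} \<Longrightarrow> t \<in> {0..1} \<Longrightarrow> 0 < u t x + \<epsilon> * \<eta> t x"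
proof -
  let ?K = "{0..1::real} \<times> cbox a b"
  have K: "compact ?K" by (intro compact_Times) auto
  have "a \<in> cbox a b" using box by (simp add: mem_box_cart less_imp_le)
  then have ne: "?K \<noteq> {}" by auto
  have c: "continuous_on ?K (\<lambda>(t, x). f t x)" if "smooth_spacetime a b f" for f :: "real \<Rightarrow> real^'n \<Rightarrow> real"
    by (rule continuous_on_subset[OF smooth_spacetime_continuous_on[OF that]]) auto
  obtain z where z: "z \<in> ?K" "\<forall>y\<in>?K. (\<lambda>(t, x). u t x) z \<le> (\<lambda>(t, x). u t x) y"
    using continuous_attains_inf[OF K ne c[OF u(1)]] by blast
  obtain t0 x0 where "z = (t0, x0)" by fastforce
  with z have 0: "t0 \<in> {0..1}" "\<And>t x. (t, x) \<in> ?K \<Longrightarrow> u t0 x0 \<le> u t x"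
    by auto
  obtain B where B: "0 < B" "\<And>t x. (t, x) \<in> ?K \<Longrightarrow> \<bar>\<eta> t x\<bar> \<le> B"
    using compact_imp_bounded[OF compact_continuous_image[OF c[OF \<eta>] K]]
    unfolding bounded_pos by fastforce
  show thesis
  proof
    \<comment> \<open>For \<epsilon> within this radius the perturbation stays strictly below the
      minimum \<open>u t0 x0\<close> in absolute value.\<close>
    show "0 < u t0 x0 / B" using B u(2)[OF 0(1)] by simp
  next
    fix \<epsilon> t x assume \<epsilon>: "\<epsilon> \<in> {-(u t0 x0 / B)<..<u t0 x0 / B}" and t: "t \<in> {0..1::real}"
    have "box_periodic a b (\<lambda>x. u t x + \<epsilon> * \<eta> t x)"
      using u(1) \<eta> t by (simp add: smooth_spacetime_def box_periodic_def)
    then obtain y where y: "y \<in> cbox a b" "u t x + \<epsilon> * \<eta> t x = u t y + \<epsilon> * \<eta> t y"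
      using box_periodic_representative[OF box] by blast
    have "\<bar>\<epsilon> * \<eta> t y\<bar> \<le> \<bar>\<epsilon>\<bar> * B"
      unfolding abs_mult using B(2)[of t y] t y by (intro mult_left_mono) auto
    also have "\<bar>\<epsilon>\<bar> < u t0 x0 / B" using \<epsilon> by auto
    then have "\<bar>\<epsilon>\<bar> * B < u t0 x0" using B by (simp add: pos_less_divide_eq)
    also have "u t0 x0 \<le> u t y" using 0(2) t y by auto
    finally show "0 < u t x + \<epsilon> * \<eta> t x" unfolding y(2) by linarith
  qed
qed

lemma smooth_density_pathI:
  assumes "smooth_spacetime a b u" "\<And>t x. t \<in> {0..1} \<Longrightarrow> 0 < u t x"
  shows "smooth_density_path a b u"
  using assms smooth_spacetime_slice[OF assms(1)]
  by (simp add: smooth_density_path_def densities_def del: atLeastAtMost_iff)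

text \<open>\<open>regular_along_paths\<close> supplies differentiation under the time integral,
  \<open>has_first_variation\<close> evaluates the inner derivative at each time, and Fubini merges
  the two integrals, the integrand being smooth.\<close>

lemma energy_integral_derivative:
  fixes u \<eta> :: "real \<Rightarrow> real^'n \<Rightarrow> real"
  assumes var: "has_first_variation a b \<F> \<delta>\<F>" "regular_along_paths a b \<F> \<delta>\<F>"
    and u: "smooth_density_path a b u" and \<eta>: "smooth_spacetime a b \<eta>"
  shows "((\<lambda>\<epsilon>. integral {0..1} (\<lambda>t. \<F> (\<lambda>x. u t x + \<epsilon> * \<eta> t x))) has_real_derivative
    integral (cbox (0, a) (1, b)) (\<lambda>(t, x). \<delta>\<F> (u t) x * \<eta> t x)) (at 0)"
proof -
  have "deriv (\<lambda>\<epsilon>. \<F> (\<lambda>x. u t x + \<epsilon> * \<eta> t x)) 0 = integral (cbox a b) (\<lambda>x. \<delta>\<F> (u t) x * \<eta> t x)"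
    if "t \<in> {0..1}" for t
    using var(1) u smooth_spacetime_slice[OF \<eta> that] that
    by (intro DERIV_imp_deriv) (auto simp: has_first_variation_def smooth_density_path_def)
  then have "integral {0..1} (\<lambda>t. deriv (\<lambda>\<epsilon>. \<F> (\<lambda>x. u t x + \<epsilon> * \<eta> t x)) 0) =
      integral {0..1} (\<lambda>t. integral (cbox a b) (\<lambda>x. \<delta>\<F> (u t) x * \<eta> t x))"
    by (intro integral_cong)
  also have "\<dots> = integral (cbox (0, a) (1, b)) (\<lambda>(t, x). \<delta>\<F> (u t) x * \<eta> t x)"
    using var(2) u \<eta>
    by (intro integral_spacetime[symmetric] smooth_spacetime_continuous_on smooth_spacetime_mult)
      (auto simp: regular_along_paths_def)
  finally have eq: "integral {0..1} (\<lambda>t. deriv (\<lambda>\<epsilon>. \<F> (\<lambda>x. u t x + \<epsilon> * \<eta> t x)) 0) = \<dots>" .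
  have "((\<lambda>\<epsilon>. integral {0..1} (\<lambda>t. \<F> (\<lambda>x. u t x + \<epsilon> * \<eta> t x))) has_real_derivative
      integral {0..1} (\<lambda>t. deriv (\<lambda>\<epsilon>. \<F> (\<lambda>x. u t x + \<epsilon> * \<eta> t x)) 0)) (at 0)"
    using var(2) u \<eta> unfolding regular_along_paths_def by blast
  then show ?thesis unfolding eq .
qed

lemma kinetic_density_continuous_on:
  fixes m :: "real \<Rightarrow> real^'n \<Rightarrow> 'c::real_normed_vector" and V :: "real \<Rightarrow> real"
  assumes "smooth_on {0<..} V" "\<And>r. 0 < r \<Longrightarrow> 0 < V r"
    and "smooth_spacetime a b m" "smooth_spacetime a b u" "\<And>t x. t \<in> {0..1} \<Longrightarrow> 0 < u t x"
  shows "continuous_on spacetime (\<lambda>(t, x). (norm (m t x))\<^sup>2 / (2 * V (u t x)))"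
proof -
  have "V (u (fst z) (snd z)) \<noteq> 0" if "z \<in> spacetime" for z
    using assms(2)[OF assms(5)] that by (metis less_irrefl mem_Times_iff)
  then show ?thesis
    using smooth_spacetime_continuous_on[OF smooth_spacetime_compose_pos[OF assms(1,4,5)]]
      smooth_spacetime_continuous_on[OF assms(3)]
    unfolding split_def by (intro continuous_intros) auto
qed

text \<open>Separates the kinetic terms, to be differentiated over the space-time box, from the
  energy, known only as a function of time. Since \<open>integral\<close> is total but additive only
  on integrable functions, each piece is first shown integrable.\<close>

lemma momentum_action_eq:
  fixes m1 :: "real \<Rightarrow> real^'n \<Rightarrow> real^'n"
  assumes V1: "smooth_on {0<..} V1" "\<And>r. 0 < r \<Longrightarrow> 0 < V1 r"
    and V2: "smooth_on {0<..} V2" "\<And>r. 0 < r \<Longrightarrow> 0 < V2 r"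
    and m: "smooth_spacetime a b m1" "smooth_spacetime a b m2"
    and u: "smooth_spacetime a b u" "\<And>t x. t \<in> {0..1} \<Longrightarrow> 0 < u t x"
    and \<F>: "(\<lambda>t. \<F> (u t)) integrable_on {0..1}"
  shows "momentum_action a b V1 V2 \<F> m1 m2 u =
    integral (cbox (0, a) (1, b)) (\<lambda>(t, x). (norm (m1 t x))\<^sup>2 / (2 * V1 (u t x))) +
    integral (cbox (0, a) (1, b)) (\<lambda>(t, x). (norm (m2 t x))\<^sup>2 / (2 * V2 (u t x))) -
    integral {0..1} (\<lambda>t. \<F> (u t))"
proof -
  define f where "f t x = (norm (m1 t x))\<^sup>2 / (2 * V1 (u t x)) + (norm (m2 t x))\<^sup>2 / (2 * V2 (u t x))" for t x
  note c = kinetic_density_continuous_on[OF V1 m(1) u] kinetic_density_continuous_on[OF V2 m(2) u]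
  have K: "cbox (0, a) (1, b) \<subseteq> (spacetime :: (real \<times> (real^'n)) set)"
    by (auto simp: spacetime_cbox)
  have cf: "continuous_on spacetime (\<lambda>(t, x). f t x)"
    using continuous_on_add[OF c] by (simp add: f_def split_def)
  have "(\<lambda>t. integral (cbox a b) (f t)) integrable_on {0..1}"
    using integral_integrable_2dim[OF continuous_on_subset[OF cf K]] by simp
  then have "momentum_action a b V1 V2 \<F> m1 m2 u =
      integral {0..1} (\<lambda>t. integral (cbox a b) (f t)) - integral {0..1} (\<lambda>t. \<F> (u t))"
    \<comment> \<open>Reading the absolute value of \<open>m2\<close> as a norm gives both kinetic
      terms the same shape.\<close>
    unfolding momentum_action_def real_norm_def[symmetric] f_def[symmetric] by (intro integral_diff \<F>)
  also have "integral {0..1} (\<lambda>t. integral (cbox a b) (f t)) = integral (cbox (0, a) (1, b)) (\<lambda>(t, x). f t x)"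
    using integral_spacetime[OF cf] by simp
  also have "\<dots> = integral (cbox (0, a) (1, b)) (\<lambda>(t, x). (norm (m1 t x))\<^sup>2 / (2 * V1 (u t x))) +
    integral (cbox (0, a) (1, b)) (\<lambda>(t, x). (norm (m2 t x))\<^sup>2 / (2 * V2 (u t x)))"
    using integral_add[OF c[THEN continuous_on_subset[OF _ K], THEN integrable_continuous]]
    by (simp add: f_def split_def)
  finally show ?thesis .
qed

lemma momentum_action_derivative:
  fixes m1 :: "real \<Rightarrow> real^'n \<Rightarrow> real^'n"
  assumes box: "\<And>i. a $ i < b $ i"
    and V1: "smooth_on {0<..} V1" "\<And>r. 0 < r \<Longrightarrow> 0 < V1 r"
    and V2: "smooth_on {0<..} V2" "\<And>r. 0 < r \<Longrightarrow> 0 < V2 r"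
    and var: "has_first_variation a b \<F> \<delta>\<F>" "regular_along_paths a b \<F> \<delta>\<F>"
    and m: "smooth_spacetime a b m1" "smooth_spacetime a b m2"
    and u: "smooth_spacetime a b u" "\<And>t x. t \<in> {0..1} \<Longrightarrow> 0 < u t x"
    and \<mu>: "smooth_spacetime a b \<mu>1" "smooth_spacetime a b \<mu>2" and \<eta>: "smooth_spacetime a b \<eta>"
  shows "((\<lambda>\<epsilon>. momentum_action a b V1 V2 \<F> (\<lambda>t x. m1 t x + \<epsilon> *\<^sub>R \<mu>1 t x)
      (\<lambda>t x. m2 t x + \<epsilon> * \<mu>2 t x) (\<lambda>t x. u t x + \<epsilon> * \<eta> t x)) has_real_derivative
    integral (cbox (0, a) (1, b)) (\<lambda>(t, x). m1 t x \<bullet> \<mu>1 t x / V1 (u t x)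
      - (norm (m1 t x))\<^sup>2 * deriv V1 (u t x) * \<eta> t x / (2 * (V1 (u t x))\<^sup>2)) +
    integral (cbox (0, a) (1, b)) (\<lambda>(t, x). m2 t x \<bullet> \<mu>2 t x / V2 (u t x)
      - (norm (m2 t x))\<^sup>2 * deriv V2 (u t x) * \<eta> t x / (2 * (V2 (u t x))\<^sup>2)) -
    integral (cbox (0, a) (1, b)) (\<lambda>(t, x). \<delta>\<F> (u t) x * \<eta> t x)) (at 0)"
proof -
  obtain r where r: "0 < r" and pos: "\<And>\<epsilon> t x. \<epsilon> \<in> {-r<..<r} \<Longrightarrow> t \<in> {0..1} \<Longrightarrow> 0 < u t x + \<epsilon> * \<eta> t x"
    using perturbed_density_pos[OF box u \<eta>] by blast
  let ?K = "cbox (0, a) (1, b) :: (real \<times> (real^'n)) set"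
  have c: "continuous_on ?K (\<lambda>z. f (fst z) (snd z))" if "smooth_spacetime a b f"
    for f :: "real \<Rightarrow> real^'n \<Rightarrow> 'z::real_normed_vector"
    using continuous_on_subset[OF smooth_spacetime_continuous_on[OF that], of ?K]
    by (auto simp: spacetime_cbox split_def)
  have posK: "0 < u (fst z) (snd z) + \<epsilon> * \<eta> (fst z) (snd z)" if "\<epsilon> \<in> {-r<..<r}" "z \<in> ?K" for \<epsilon> z
    using pos that by (auto simp: spacetime_cbox)
  note kin1 = kinetic_integral_derivative[OF V1 c[OF m(1)] c[OF \<mu>(1)] c[OF u(1)] c[OF \<eta>] r posK]
  note kin2 = kinetic_integral_derivative[OF V2 c[OF m(2)] c[OF \<mu>(2)] c[OF u(1)] c[OF \<eta>] r posK]
  note en = energy_integral_derivative[OF var smooth_density_pathI[OF u] \<eta>]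
  have "momentum_action a b V1 V2 \<F> (\<lambda>t x. m1 t x + \<epsilon> *\<^sub>R \<mu>1 t x)
      (\<lambda>t x. m2 t x + \<epsilon> * \<mu>2 t x) (\<lambda>t x. u t x + \<epsilon> * \<eta> t x) =
    integral ?K (\<lambda>(t, x). (norm (m1 t x + \<epsilon> *\<^sub>R \<mu>1 t x))\<^sup>2 / (2 * V1 (u t x + \<epsilon> * \<eta> t x))) +
    integral ?K (\<lambda>(t, x). (norm (m2 t x + \<epsilon> *\<^sub>R \<mu>2 t x))\<^sup>2 / (2 * V2 (u t x + \<epsilon> * \<eta> t x))) -
    integral {0..1} (\<lambda>t. \<F> (\<lambda>x. u t x + \<epsilon> * \<eta> t x))" if \<epsilon>: "\<epsilon> \<in> {-r<..<r}" for \<epsilon>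
  proof -
    note sm = smooth_spacetime_add smooth_spacetime_scaleR smooth_spacetime_mult smooth_spacetime_const
    have w: "smooth_spacetime a b (\<lambda>t x. u t x + \<epsilon> * \<eta> t x)"
      by (intro sm u \<eta>)
    have "(\<lambda>t. \<F> (\<lambda>x. u t x + \<epsilon> * \<eta> t x)) integrable_on {0..1}"
      using var(2) smooth_density_pathI[OF w pos[OF \<epsilon>]] by (simp add: regular_along_paths_def)
    moreover have "smooth_spacetime a b (\<lambda>t x. m1 t x + \<epsilon> *\<^sub>R \<mu>1 t x)"
      "smooth_spacetime a b (\<lambda>t x. m2 t x + \<epsilon> *\<^sub>R \<mu>2 t x)"
      by (intro sm m \<mu>)+
    ultimately show ?thesis
      using momentum_action_eq[OF V1 V2 _ _ w pos[OF \<epsilon>]] by simp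
  qed
  note eq = this
  \<comment> \<open>The split form \<open>eq\<close> of the action holds only for \<epsilon> in
    \<open>{-r<..<r}\<close>; as this is an open set around 0, the derivative at 0 is
    unaffected.\<close>
  show ?thesis
    unfolding split_def
    by (rule has_field_derivative_transform_within_open[
          OF DERIV_diff[OF DERIV_add[OF kin1 kin2] en, unfolded split_def], of "{-r<..<r}"])
      (use r in \<open>simp_all only: eq split_def, simp_all\<close>)
qed

lemma time_derivI:
  assumes "((\<lambda>s. f s x) has_vector_derivative D) (at t within {0..1})" "t \<in> {0..1}"
  shows "time_deriv f t x = D"
  unfolding time_deriv_def
  by (rule vector_derivative_within_cbox[of 0 1, simplified]) (use assms in auto)

lemma has_vector_derivative_time_deriv:
  assumes "smooth_spacetime a b f" "t \<in> {0..1}"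
  shows "((\<lambda>s. f s x) has_vector_derivative time_deriv f t x) (at t within {0..1})"
  using spacetime_has_time_derivative[OF assms] time_deriv_eq[OF assms] by simp

lemma smooth_spacetime_integrable:
  assumes "smooth_spacetime a b f"
  shows "(\<lambda>(t, x). f t x :: real) integrable_on cbox (0, a) (1, b)"
  by (intro integrable_continuous
      continuous_on_subset[OF smooth_spacetime_continuous_on[OF assms]])
    (auto simp: spacetime_cbox)

lemma critical_point_weak_form:
  fixes v1 :: "real \<Rightarrow> real^'n \<Rightarrow> real^'n"
  assumes box: "\<And>i. a $ i < b $ i"
    and V1: "smooth_on {0<..} V1" "\<And>r. 0 < r \<Longrightarrow> 0 < V1 r"
    and V2: "smooth_on {0<..} V2" "\<And>r. 0 < r \<Longrightarrow> 0 < V2 r"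
    and var: "has_first_variation a b \<F> \<delta>\<F>" "regular_along_paths a b \<F> \<delta>\<F>"
    and critical: "critical_point a b V1 V2 \<F> u0 u1 v1 v2 u"
    and pos: "\<And>t x. t \<in> {0..1} \<Longrightarrow> 0 < u t x"
    and \<mu>: "smooth_spacetime a b \<mu>" and \<eta>: "smooth_spacetime a b \<eta>"
    and \<eta>0: "\<And>x. \<eta> 0 x = 0" "\<And>x. \<eta> 1 x = 0"
  shows "integral (cbox (0, a) (1, b)) (\<lambda>(t, x).
      v1 t x \<bullet> \<mu> t x + v2 t x * (time_deriv \<eta> t x + divergence (\<mu> t) x)
      - (1/2 * (norm (v1 t x))\<^sup>2 * deriv V1 (u t x) + 1/2 * \<bar>v2 t x\<bar>\<^sup>2 * deriv V2 (u t x)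
         + \<delta>\<F> (u t) x) * \<eta> t x) = 0"
proof -
  define \<mu>2 where "\<mu>2 t x = time_deriv \<eta> t x + divergence (\<mu> t) x" for t x
  let ?K = "cbox (0, a) (1, b) :: (real \<times> (real^'n)) set"
  have v: "smooth_spacetime a b v1" "smooth_spacetime a b v2" and u: "smooth_spacetime a b u"
    using critical by (auto simp: critical_point_def feasible_def)
  have comp: "smooth_spacetime a b (\<lambda>t x. g (u t x))" if "smooth_on {0<..} g" for g :: "real \<Rightarrow> real"
    by (rule smooth_spacetime_compose_pos[OF that u pos])
  note sm = smooth_spacetime_add smooth_spacetime_diff smooth_spacetime_scaleR smooth_spacetime_mult
    smooth_spacetime_inner smooth_spacetime_const comp smooth_on_pos_deriv
  have \<mu>2: "smooth_spacetime a b \<mu>2"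
    unfolding \<mu>2_def by (intro sm smooth_spacetime_time_deriv smooth_spacetime_divergence \<mu> \<eta>)
  define m1 where "m1 t x = V1 (u t x) *\<^sub>R v1 t x" for t x
  define m2 where "m2 t x = V2 (u t x) * v2 t x" for t x
  have m: "smooth_spacetime a b m1" "smooth_spacetime a b m2"
    unfolding m1_def m2_def by (intro sm v V1 V2)+
  \<comment> \<open>\<open>f1\<close> and \<open>f2\<close> are the kinetic integrands after
    inserting \<open>m1\<close> and \<open>m2\<close>: one factor of the mobility cancels in the
    linear term, two in the quadratic one. Squares are written as products so that the closure rules
    give smoothness.\<close>
  define f1 where "f1 t x = v1 t x \<bullet> \<mu> t x - 1/2 * (v1 t x \<bullet> v1 t x) * deriv V1 (u t x) * \<eta> t x" for t x
  define f2 where "f2 t x = v2 t x * \<mu>2 t x - 1/2 * (v2 t x * v2 t x) * deriv V2 (u t x) * \<eta> t x" for t x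
  define f3 where "f3 t x = \<delta>\<F> (u t) x * \<eta> t x" for t x
  have \<delta>: "smooth_spacetime a b (\<lambda>t. \<delta>\<F> (u t))"
    using var(2) smooth_density_pathI[OF u pos] by (simp add: regular_along_paths_def)
  have f: "smooth_spacetime a b f1" "smooth_spacetime a b f2" "smooth_spacetime a b f3"
    unfolding f1_def f2_def f3_def by (intro sm v V1 V2 \<mu> \<mu>2 \<eta> \<delta>)+
  note fi = f[THEN smooth_spacetime_integrable]
  have "continuity_equation \<mu> \<mu>2 \<eta>"
    by (simp add: continuity_equation_def \<mu>2_def)
  then have "((\<lambda>\<epsilon>. momentum_action a b V1 V2 \<F> (\<lambda>t x. m1 t x + \<epsilon> *\<^sub>R \<mu> t x)
      (\<lambda>t x. m2 t x + \<epsilon> * \<mu>2 t x) (\<lambda>t x. u t x + \<epsilon> * \<eta> t x)) has_real_derivative 0) (at 0)"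
    using critical \<mu> \<mu>2 \<eta> \<eta>0 unfolding critical_point_def m1_def m2_def by blast
  from DERIV_unique[OF momentum_action_derivative[OF box V1 V2 var m u pos \<mu> \<mu>2 \<eta>] this]
  have "integral ?K (\<lambda>(t, x). m1 t x \<bullet> \<mu> t x / V1 (u t x)
      - (norm (m1 t x))\<^sup>2 * deriv V1 (u t x) * \<eta> t x / (2 * (V1 (u t x))\<^sup>2)) +
    integral ?K (\<lambda>(t, x). m2 t x \<bullet> \<mu>2 t x / V2 (u t x)
      - (norm (m2 t x))\<^sup>2 * deriv V2 (u t x) * \<eta> t x / (2 * (V2 (u t x))\<^sup>2)) -
    integral ?K (\<lambda>(t, x). f3 t x) = 0"
    unfolding f3_def .
  moreover have "integral ?K (\<lambda>(t, x). m1 t x \<bullet> \<mu> t x / V1 (u t x)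
      - (norm (m1 t x))\<^sup>2 * deriv V1 (u t x) * \<eta> t x / (2 * (V1 (u t x))\<^sup>2)) =
    integral ?K (\<lambda>(t, x). f1 t x)"
  proof -
    have "m1 t x \<bullet> \<mu> t x / V1 (u t x)
      - (norm (m1 t x))\<^sup>2 * deriv V1 (u t x) * \<eta> t x / (2 * (V1 (u t x))\<^sup>2) = f1 t x"
      if "t \<in> {0..1}" for t x
      using V1(2)[OF pos[OF that, of x]] unfolding power2_norm_eq_inner
      by (simp add: m1_def f1_def power2_eq_square field_simps)
    then show ?thesis by (intro integral_cong) (auto simp: spacetime_cbox)
  qed
  moreover have "integral ?K (\<lambda>(t, x). m2 t x \<bullet> \<mu>2 t x / V2 (u t x)
      - (norm (m2 t x))\<^sup>2 * deriv V2 (u t x) * \<eta> t x / (2 * (V2 (u t x))\<^sup>2)) =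
    integral ?K (\<lambda>(t, x). f2 t x)"
  proof -
    have "m2 t x \<bullet> \<mu>2 t x / V2 (u t x)
      - (norm (m2 t x))\<^sup>2 * deriv V2 (u t x) * \<eta> t x / (2 * (V2 (u t x))\<^sup>2) = f2 t x"
      if "t \<in> {0..1}" for t x
      using V2(2)[OF pos[OF that, of x]] unfolding power2_norm_eq_inner
      by (simp add: m2_def f2_def power2_eq_square field_simps)
    then show ?thesis by (intro integral_cong) (auto simp: spacetime_cbox)
  qed
  ultimately have "integral ?K (\<lambda>z. (\<lambda>(t, x). f1 t x) z + (\<lambda>(t, x). f2 t x) z - (\<lambda>(t, x). f3 t x) z) = 0"
    using fi by (simp add: integral_add integral_diff integrable_add)
  then show ?thesis
    unfolding power2_norm_eq_inner
    by (simp add: f1_def f2_def f3_def \<mu>2_def split_def power2_eq_square algebra_simps)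
qed

section \<open>From the weak form to the system for the potential\<close>

lemma time_deriv_mult:
  assumes f: "smooth_spacetime a b f" and g: "smooth_spacetime a b g" and t: "t \<in> {0..1}"
  shows "time_deriv (\<lambda>t x. f t x * g t x) t x = f t x * time_deriv g t x + time_deriv f t x * g t x"
  by (rule time_derivI[OF has_vector_derivative_mult[OF has_vector_derivative_time_deriv[OF f t]
        has_vector_derivative_time_deriv[OF g t]] t])

lemma smooth_space_differentiable:
  assumes "smooth_space a b f" shows "f differentiable (at x)"
  using smooth_on_has_derivative[of UNIV f x] assms by (auto simp: smooth_space_def intro: differentiableI)

lemma smooth_on_mobility:
  assumes "smooth_on {0<..} F" "smooth_on {0<..} G" "\<And>r. 0 < r \<Longrightarrow> 0 < deriv (deriv G) r"
  shows "smooth_on {0<..} (mobility F G)"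
proof -
  have S: "approachable {0::real<..}" by (intro approachable_open) auto
  have "smooth_on {0<..} (\<lambda>r. deriv F r * inverse (deriv (deriv G) r))"
    using assms
    by (intro smooth_on_bilinear[OF bounded_bilinear_mult S] smooth_on_pos_deriv
        smooth_on_compose_pos[OF S smooth_on_inverse_pos]) auto
  then show ?thesis by (simp add: mobility_def[abs_def] divide_inverse)
qed

theorem proposition6:
  fixes a b :: "real^'n"
    and F G R V1 V2 :: "real \<Rightarrow> real"
    and \<F> :: "(real^'n \<Rightarrow> real) \<Rightarrow> real"
    and \<delta>\<F> :: "(real^'n \<Rightarrow> real) \<Rightarrow> real^'n \<Rightarrow> real"
    and u0 u1 :: "real^'n \<Rightarrow> real"
    and v1 :: "real \<Rightarrow> real^'n \<Rightarrow> real^'n"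
    and v2 u :: "real \<Rightarrow> real^'n \<Rightarrow> real"
  assumes box: "\<And>i. a $ i < b $ i"
    and smooth: "smooth_on {0<..} F" "smooth_on {0<..} G" "smooth_on {0<..} R"
    and F': "\<And>r. 0 < r \<Longrightarrow> 0 < deriv F r"
    and G'': "\<And>r. 0 < r \<Longrightarrow> 0 < deriv (deriv G) r"
    and V1: "V1 = mobility F G"
    and V2: "smooth_on {0<..} V2" "\<And>r. 0 < r \<Longrightarrow> 0 < V2 r"
            "\<And>r. 0 < r \<Longrightarrow> V2 r * deriv G r = - R r"
    and variation: "has_first_variation a b \<F> \<delta>\<F>" "regular_along_paths a b \<F> \<delta>\<F>"
    and boundary: "u0 \<in> densities a b" "u1 \<in> densities a b"
    and critical: "critical_point a b V1 V2 \<F> u0 u1 v1 v2 u"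
    and positive: "\<And>t x. t \<in> {0..1} \<Longrightarrow> 0 < u t x"
  shows "\<exists>\<Phi> :: real \<Rightarrow> real^'n \<Rightarrow> real.
    smooth_spacetime a b \<Phi> \<and>
    (\<forall>t\<in>{0..1}. \<forall>x.
       v1 t x = grad (\<Phi> t) x \<and>
       v2 t x = \<Phi> t x \<and>
       time_deriv u t x + divergence (\<lambda>y. V1 (u t y) *\<^sub>R grad (\<Phi> t) y) x = V2 (u t x) * \<Phi> t x \<and>
       time_deriv \<Phi> t x + 1/2 * (norm (grad (\<Phi> t) x))\<^sup>2 * deriv V1 (u t x)
         + 1/2 * \<bar>\<Phi> t x\<bar>\<^sup>2 * deriv V2 (u t x) + \<delta>\<F> (u t) x = 0) \<and>
    (\<forall>x. u 0 x = u0 x \<and> u 1 x = u1 x)"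
proof -
  have V1s: "smooth_on {0<..} V1"
    unfolding V1 by (rule smooth_on_mobility[OF smooth(1,2) G''])
  have V1p: "0 < V1 r" if "0 < r" for r
    using F'[OF that] G''[OF that] by (simp add: V1 mobility_def)
  have v: "smooth_spacetime a b v1" "smooth_spacetime a b v2" and u: "smooth_spacetime a b u"
    and cont: "continuity_equation (\<lambda>t x. V1 (u t x) *\<^sub>R v1 t x) (\<lambda>t x. v2 t x * V2 (u t x)) u"
    and ends: "u 0 x = u0 x" "u 1 x = u1 x" for x
    using critical by (auto simp: critical_point_def feasible_def)
  let ?K = "cbox (0, a) (1, b) :: (real \<times> (real^'n)) set"
  define E where "E t x = 1/2 * (norm (v1 t x))\<^sup>2 * deriv V1 (u t x)
    + 1/2 * \<bar>v2 t x\<bar>\<^sup>2 * deriv V2 (u t x) + \<delta>\<F> (u t) x" for t x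
  have weak: "integral ?K (\<lambda>(t, x). v1 t x \<bullet> \<mu> t x
      + v2 t x * (time_deriv \<eta> t x + divergence (\<mu> t) x) - E t x * \<eta> t x) = 0"
    if "smooth_spacetime a b \<mu>" "smooth_spacetime a b \<eta>" "\<And>x. \<eta> 0 x = 0" "\<And>x. \<eta> 1 x = 0" for \<mu> \<eta>
    unfolding E_def
    by (rule critical_point_weak_form[OF box V1s V1p V2(1,2) variation critical positive that])
  have comp: "smooth_spacetime a b (\<lambda>t x. g (u t x))" if "smooth_on {0<..} g" for g :: "real \<Rightarrow> real"
    by (rule smooth_spacetime_compose_pos[OF that u positive])
  note sm = smooth_spacetime_add smooth_spacetime_diff smooth_spacetime_scaleR smooth_spacetime_mult
    smooth_spacetime_inner smooth_spacetime_const smooth_spacetime_time comp smooth_on_pos_deriv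
  have slice: "f t differentiable (at x)" if "smooth_spacetime a b f" "t \<in> {0..1}"
    for f :: "real \<Rightarrow> real^'n \<Rightarrow> 'z::real_normed_vector" and t x
    by (rule smooth_space_differentiable[OF smooth_spacetime_slice[OF that]])

  have grad: "v1 t x = grad (v2 t) x" if t: "t \<in> {0..1}" for t x
  proof -
    define \<mu> where "\<mu> t x = v1 t x - grad (v2 t) x" for t x
    have \<mu>: "smooth_spacetime a b \<mu>"
      unfolding \<mu>_def by (intro sm v smooth_spacetime_grad)
    \<comment> \<open>Since \<mu> is \<open>v1\<close> minus the gradient of \<open>v2\<close>, the
      product rule turns the weak integrand for zero \<eta> into the square of \<mu> plus the exact
      divergence \<open>d\<close>, which integrates to zero over the box at each time.\<close>
    define d where "d t = divergence (\<lambda>y. v2 t y *\<^sub>R \<mu> t y)" for t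
    have p: "smooth_spacetime a b (\<lambda>t y. v2 t y *\<^sub>R \<mu> t y)" by (intro sm v \<mu>)
    then have d: "smooth_spacetime a b d"
      unfolding d_def by (rule smooth_spacetime_divergence)
    have n: "smooth_spacetime a b (\<lambda>t x. \<mu> t x \<bullet> \<mu> t x)" by (intro sm \<mu>)
    have "time_deriv (\<lambda>t x. 0 :: real) t x = 0" if "t \<in> {0..1}" for t and x :: "real^'n"
      by (intro time_derivI that has_vector_derivative_const)
    then have "v1 t x \<bullet> \<mu> t x + v2 t x * (time_deriv (\<lambda>t x. 0) t x + divergence (\<mu> t) x)
        = \<mu> t x \<bullet> \<mu> t x + d t x" if "t \<in> {0..1}" for t x
      using that divergence_scaleR[OF slice[OF v(2) that] slice[OF \<mu> that], of x]
      by (simp add: d_def \<mu>_def inner_diff_left)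
    then have "integral ?K (\<lambda>(t, x). v1 t x \<bullet> \<mu> t x
          + v2 t x * (time_deriv (\<lambda>t x. 0) t x + divergence (\<mu> t) x)) =
        integral ?K (\<lambda>z. (\<lambda>(t, x). \<mu> t x \<bullet> \<mu> t x) z + (\<lambda>(t, x). d t x) z)"
      by (intro integral_cong) (auto simp: spacetime_cbox)
    moreover have "integral ?K (\<lambda>(t, x). d t x) = 0"
    proof -
      have "integral (cbox a b) (d t) = 0" if "t \<in> {0..1}" for t
        unfolding d_def by (rule integral_divergence_periodic[OF box smooth_spacetime_slice[OF p that]])
      then have "integral {0..1} (\<lambda>t. integral (cbox a b) (d t)) = integral {0..1::real} (\<lambda>t. 0)"
        by (rule integral_cong)
      then show ?thesis
        using integral_spacetime[OF smooth_spacetime_continuous_on[OF d]] by simp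
    qed
    ultimately have "integral ?K (\<lambda>(t, x). \<mu> t x \<bullet> \<mu> t x) = 0"
      using weak[OF \<mu> smooth_spacetime_const[of a b 0]]
        integral_add[OF n[THEN smooth_spacetime_integrable] d[THEN smooth_spacetime_integrable]]
      by simp
    from smooth_spacetime_eq_0I[OF box n _ this t] have "\<mu> t x \<bullet> \<mu> t x = 0" by simp
    then show ?thesis by (simp add: \<mu>_def)
  qed

  define H where "H t x = time_deriv v2 t x + E t x" for t x
  have E: "smooth_spacetime a b E"
  proof -
    have \<delta>: "smooth_spacetime a b (\<lambda>t. \<delta>\<F> (u t))"
      using variation(2) smooth_density_pathI[OF u positive] by (simp add: regular_along_paths_def)
    show ?thesis
      \<comment> \<open>Norm and absolute value occur only squared; rewritten as an inner product
        and a product they fall under the closure rules.\<close>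
      unfolding E_def power2_abs power2_norm_eq_inner
      unfolding power2_eq_square by (intro sm v V1s V2 \<delta>)
  qed
  have H: "smooth_spacetime a b H"
    unfolding H_def by (intro sm smooth_spacetime_time_deriv v E)
  have H0: "H t x = 0" if t: "t \<in> {0..1}" for t x
  proof -
    \<comment> \<open>The weight \<open>t * (1 - t)\<close> vanishes at both end times, which makes
      \<eta> admissible, and is positive in between, so the weighted square of \<open>H\<close>
      keeps its sign.\<close>
    define \<eta> where "\<eta> t x = t * (1 - t) * H t x" for t and x :: "real^'n"
    have \<eta>: "smooth_spacetime a b \<eta>" unfolding \<eta>_def by (intro sm H)
    define q where "q t x = v2 t x * \<eta> t x" for t x
    have q: "smooth_spacetime a b q" unfolding q_def by (intro sm v \<eta>)
    have n: "smooth_spacetime a b (\<lambda>t x. t * (1 - t) * (H t x * H t x))" by (intro sm H)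
    have "divergence (\<lambda>x. 0 :: real^'n) x = 0" for x :: "real^'n"
      by (simp add: divergence_def frechet_derivative_const)
    moreover have "time_deriv q t x = v2 t x * time_deriv \<eta> t x + time_deriv v2 t x * \<eta> t x"
      if "t \<in> {0..1}" for t x
      unfolding q_def by (rule time_deriv_mult[OF v(2) \<eta> that])
    \<comment> \<open>By the product rule \<open>v2\<close> times the time derivative of \<eta> is
      that of \<open>q\<close> minus \<open>time_deriv v2 t x * \<eta> t x\<close>; the latter joins
      the term with \<open>E\<close> to form \<open>H t x * \<eta> t x\<close>. The total derivative
      of \<open>q\<close> integrates to zero.\<close>
    ultimately have "v1 t x \<bullet> 0 + v2 t x * (time_deriv \<eta> t x + divergence (\<lambda>x. 0) x) - E t x * \<eta> t x
        = time_deriv q t x - t * (1 - t) * (H t x * H t x)" if "t \<in> {0..1}" for t x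
      using that by (simp add: \<eta>_def H_def algebra_simps)
    then have "integral ?K (\<lambda>(t, x). v1 t x \<bullet> 0
          + v2 t x * (time_deriv \<eta> t x + divergence (\<lambda>x. 0) x) - E t x * \<eta> t x) =
        integral ?K (\<lambda>z. (\<lambda>(t, x). time_deriv q t x) z - (\<lambda>(t, x). t * (1 - t) * (H t x * H t x)) z)"
      by (intro integral_cong) (auto simp: spacetime_cbox)
    moreover have "integral ?K (\<lambda>(t, x). time_deriv q t x) = 0"
      by (rule integral_time_deriv[OF q]) (simp_all add: q_def \<eta>_def)
    moreover have "integral ?K (\<lambda>(t, x). v1 t x \<bullet> 0
          + v2 t x * (time_deriv \<eta> t x + divergence (\<lambda>x. 0) x) - E t x * \<eta> t x) = 0"
      by (rule weak[OF smooth_spacetime_const \<eta>]) (simp_all add: \<eta>_def)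
    ultimately have int: "integral ?K (\<lambda>(t, x). t * (1 - t) * (H t x * H t x)) = 0"
      using integral_diff[OF smooth_spacetime_time_deriv[OF q, THEN smooth_spacetime_integrable]
          n[THEN smooth_spacetime_integrable]]
      by simp
    have "t * (1 - t) * (H t x * H t x) = 0" if "t \<in> {0..1}" for t x
      by (rule smooth_spacetime_eq_0I[OF box n _ int that]) simp
    \<comment> \<open>The weight can be divided out only at interior times; the values at 0 and 1
      follow by continuity, as the closure of the open interval contains them.\<close>
    then have "H t x = 0" if "t \<in> {0<..<1}" for t
      using that by (metis diff_gt_0_iff_gt greaterThanLessThan_iff greaterThanLessThan_subseteq_atLeastAtMost_iff
          less_irrefl mult_eq_0_iff order_refl subsetD)
    moreover have "continuous_on {0..1} (\<lambda>t. H t x)"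
    proof -
      have "continuous_on {0..1} (\<lambda>t. (\<lambda>(t, x). H t x) (t, x))"
        by (rule continuous_on_compose2[OF smooth_spacetime_continuous_on[OF H]])
          (auto intro!: continuous_intros)
      then show ?thesis by simp
    qed
    ultimately show ?thesis
      using continuous_constant_on_closure[of "{0<..<1}" "\<lambda>t. H t x" 0 t] t by simp
  qed

  show ?thesis
  proof (intro exI[of _ v2] conjI ballI allI)
    fix t x assume t: "t \<in> {0..1::real}"
    \<comment> \<open>Equality as functions of space is required, because the gradient is replaced
      under \<open>divergence\<close>.\<close>
    have "grad (v2 t) = v1 t" using grad[OF t] by auto
    then show "time_deriv u t x + divergence (\<lambda>y. V1 (u t y) *\<^sub>R grad (v2 t) y) x = V2 (u t x) * v2 t x"
      using cont t unfolding continuity_equation_def by (simp add: mult.commute)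
    show "time_deriv v2 t x + 1/2 * (norm (grad (v2 t) x))\<^sup>2 * deriv V1 (u t x)
        + 1/2 * \<bar>v2 t x\<bar>\<^sup>2 * deriv V2 (u t x) + \<delta>\<F> (u t) x = 0"
      using H0[OF t, of x] grad[OF t, of x] by (simp add: H_def E_def)
  qed (use v ends grad in auto)
qed

end
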